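(* Let $1\le p<\infty$, $0<\theta_2<\infty$ and $\omega\in A^{\rho,\theta_2}_p(\mathbb R^d)$. Let $0<\beta<1$ and let $N_0$ be the constant fixed in the context. Then the following statements are true. (1) Let $0<\theta_1<\infty$. There is a constant $C>0$, independent of $f$ and $\mathcal B$, such that for every $f\in \mathrm{Lip}_\beta^{\rho,\theta_1}(\mathbb R^d)$ and every ball $\mathcal B=B(x_0,r)\subset\mathbb R^d$, $$\frac{1}{|\mathcal B|^{\beta/d}}\bigg(\frac{1}{\omega(\mathcal B)}\int_{\mathcal B}|f(x)-f_{\mathcal B}|^p\,\omega(x)\,dx\bigg)^{1/p}\le C\bigg(1+\frac{r}{\rho(x_0)}\bigg)^{(N_0+1)\theta_1}\|f\|_{\mathrm{Lip}_\beta^{\rho,\theta_1}}.$$ (2) Conversely, let $f\in L^1_{\mathrm{loc}}(\mathbb R^d)$ be real-valued. If there exist a constant $C>0$ and some $\theta_1>0$ such that for every ball $\mathcal B=B(x_0,r)\subset\mathbb R^d$, $$\frac{1}{|\mathcal B|^{\beta/d}}\bigg(\frac{1}{\omega(\mathcal B)}\int_{\mathcal B}|f(x)-f_{\mathcal B}|^p\,\omega(x)\,dx\bigg)^{1/p}\le C\bigg(1+\frac{r}{\rho(x_0)}\bigg)^{\theta_1-\theta_2},$$ then $f\in \mathrm{Lip}_\beta^{\rho,\theta_1}(\mathbb R^d)$ and $$\|f\|_{\mathrm{Lip}_\beta^{\rho,\theta_1}}\le C'\,[\omega]_{A^{\rho,\theta_2}_p},$$ where $C'>0$ depends only on $C,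d,p,\beta,\theta_1,\theta_2$.
   Context: Setting: $d\ge 3$, and $V:\mathbb R^d\to[0,\infty)$ is locally integrable, not identically zero, and belongs to the reverse Hölder class $RH_s(\mathbb R^d)$ for some $s\ge d/2$, i.e. there is a constant $C>0$ with $\big(\frac1{|B|}\int_B V^s\big)^{1/s}\le C\,\frac1{|B|}\int_B V$ for every ball $B$ (usual modification if $s=\infty$). $B(x,r)$ is the open ball with center $x$ and radius $r$. The critical radius function is $$\rho(x):=\sup\Big\{r>0:\ \frac{1}{r^{d-2}}\int_{B(x,r)}V(y)\,dy\le 1\Big\},\qquad x\in\mathbb R^d,$$ which satisfies $0<\rho(x)<\infty$. Constant $N_0$: it is known (Shen) that there are constants $C_0\ge1$, $N_0>0$ such that for all $x,y\in\mathbb R^d$ $$\frac1{C_0}\Big(1+\frac{|x-y|}{\rho(x)}\Big)^{-N_0}\le\frac{\rho(y)}{\rho(x)}\le C_0\Big(1+\frac{|x-y|}{\rho(x)}\Big)^{\frac{N_0}{N_0+1}};$$ such constants are fixed. Weights: a weight is a nonnegative locally integrable function $\omega$ on $\mathbb R^d$, not a.e. zero; $\omega(E):=\int_E\omega(x)\,dx$. Let $p'$ denote the conjugate exponent, $1/p+1/p'=1$. For $0<\theta<\infty$ and $1<p<\infty$, $\omega\in A_p^{\rho,\theta}(\mathbb R^d)$ means $[\omega]_{A_p^{\rho,\theta}}<\infty$, where $$[\omega]_{A^{\rho,\theta}_p}:=\sup_{B=B(x_0,r)}\Big(1+\frac r{\rho(x_0)}\Big)^{-\theta}\Big(\frac1{|B|}\int_B\omega\Big)^{1/p}\Big(\frac1{|B|}\int_B\omega^{-p'/p}\Big)^{1/p'},$$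 and $\omega\in A_1^{\rho,\theta}(\mathbb R^d)$ means $[\omega]_{A_1^{\rho,\theta}}:=\sup_{B=B(x_0,r)}\big(1+\frac r{\rho(x_0)}\big)^{-\theta}\big(\frac1{|B|}\int_B\omega\big)\big(\operatorname{ess\,inf}_{B}\omega\big)^{-1}<\infty$. Lipschitz spaces: $f_B:=\frac1{|B|}\int_B f$. For $0<\theta<\infty$ and $0<\beta<1$, $\mathrm{Lip}_\beta^{\rho,\theta}(\mathbb R^d)$ is the set of real-valued $f\in L^1_{\mathrm{loc}}(\mathbb R^d)$ with $$\|f\|_{\mathrm{Lip}_\beta^{\rho,\theta}}:=\sup_{B=B(x_0,r)}\Big(1+\frac r{\rho(x_0)}\Big)^{-\theta}\frac1{|B|^{1+\beta/d}}\int_B|f(x)-f_B|\,dx<\infty,$$ the supremum being over all balls $B(x_0,r)$, $x_0\in\mathbb R^d$, $r>0$. Elements of $\mathrm{Lip}_\beta^{\rho,\theta}$ are identified with their continuous representatives. *)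

theory Defs
  imports "HOL-Analysis.Analysis" "HOL-Probability.Essential_Supremum"
begin

text \<open>Real power of an extended nonnegative number; meant for exponents \<open>t > 0\<close> only, so that
  \<open>\<infinity> ^ t = \<infinity>\<close>.\<close>
definition epow :: "ennreal \<Rightarrow> real \<Rightarrow> ennreal" where
  "epow a t = (if a = \<infinity> then \<infinity> else ennreal (enn2real a powr t))"

definition locally_integrable :: "('a::euclidean_space \<Rightarrow> real) \<Rightarrow> bool" where
  "locally_integrable f \<longleftrightarrow> (\<forall>K. compact K \<longrightarrow> f absolutely_integrable_on K)"

definition avg :: "'a::euclidean_space set \<Rightarrow> ('a \<Rightarrow> real) \<Rightarrow> real" where
  "avg B f = (LINT x:B|lebesgue. f x) / measure lebesgue B"

text \<open>The average of a nonnegative function, with value \<open>\<infinity>\<close> if the integral diverges.\<close>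
definition eavg :: "'a::euclidean_space set \<Rightarrow> ('a \<Rightarrow> ennreal) \<Rightarrow> ennreal" where
  "eavg B g = (\<integral>\<^sup>+x\<in>B. g x \<partial>lebesgue) / emeasure lebesgue B"

definition reverse_holder :: "ereal \<Rightarrow> ('a::euclidean_space \<Rightarrow> real) \<Rightarrow> bool" where
  "reverse_holder s V \<longleftrightarrow> (\<exists>C>0. \<forall>x. \<forall>r>0.
     (if s = \<infinity> then esssup (lebesgue_on (ball x r)) (\<lambda>y. ennreal (V y))
      else epow (eavg (ball x r) (\<lambda>y. ennreal (V y powr real_of_ereal s))) (1 / real_of_ereal s))
     \<le> ennreal (C * avg (ball x r) V))"

text \<open>``Not identically zero'' is meant almost everywhere, as for any element of \<open>L\<^sup>1\<^sub>l\<^sub>o\<^sub>c\<close>;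
  otherwise the critical radius below would be infinite.\<close>
definition admissible_potential :: "ereal \<Rightarrow> ('a::euclidean_space \<Rightarrow> real) \<Rightarrow> bool" where
  "admissible_potential s V \<longleftrightarrow>
     (\<forall>x. 0 \<le> V x) \<and> locally_integrable V \<and> \<not> (AE x in lebesgue. V x = 0) \<and>
     ereal (DIM('a) / 2) \<le> s \<and> reverse_holder s V"

text \<open>For admissible potentials in dimension at least 3 the set is nonempty and bounded, so the
  supremum in the reals is the intended one.\<close>
definition critical_radius :: "('a::euclidean_space \<Rightarrow> real) \<Rightarrow> 'a \<Rightarrow> real" where
  "critical_radius V x =
     Sup {r. 0 < r \<and> 1 / r ^ (DIM('a) - 2) * (LINT y:ball x r|lebesgue. V y) \<le> 1}"

text \<open>The pair \<open>(C\<^sub>0, N\<^sub>0)\<close> is admissible in Shen's comparison of critical radii.\<close>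
definition shen_constants :: "('a::euclidean_space \<Rightarrow> real) \<Rightarrow> real \<Rightarrow> real \<Rightarrow> bool" where
  "shen_constants \<rho> C\<^sub>0 N\<^sub>0 \<longleftrightarrow> 1 \<le> C\<^sub>0 \<and> 0 < N\<^sub>0 \<and>
     (\<forall>x y. 1 / C\<^sub>0 * (1 + dist x y / \<rho> x) powr (- N\<^sub>0) \<le> \<rho> y / \<rho> x \<and>
            \<rho> y / \<rho> x \<le> C\<^sub>0 * (1 + dist x y / \<rho> x) powr (N\<^sub>0 / (N\<^sub>0 + 1)))"

definition weight :: "('a::euclidean_space \<Rightarrow> real) \<Rightarrow> bool" where
  "weight \<omega> \<longleftrightarrow> (\<forall>x. 0 \<le> \<omega> x) \<and> locally_integrable \<omega> \<and> \<not> (AE x in lebesgue. \<omega> x = 0)"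

definition wmeasure :: "('a::euclidean_space \<Rightarrow> real) \<Rightarrow> 'a set \<Rightarrow> ennreal" where
  "wmeasure \<omega> E = (\<integral>\<^sup>+x\<in>E. ennreal (\<omega> x) \<partial>lebesgue)"

definition conj_exp :: "real \<Rightarrow> real" where
  "conj_exp p = p / (p - 1)"

text \<open>\<open>\<omega>\<close> to the power \<open>-p'/p\<close> is written as an \<^typ>\<open>ennreal\<close> inverse so that it is \<open>\<infinity>\<close>, and not
  \<open>0\<close>, where \<open>\<omega>\<close> vanishes. The essential infimum over \<open>B\<close> is the lower limit along the filter of
  almost-everywhere statements on \<open>B\<close>, dual to the library's \<^const>\<open>esssup\<close>.\<close>
definition Ap_char :: "('a::euclidean_space \<Rightarrow> real) \<Rightarrow> real \<Rightarrow> real \<Rightarrow> ('a \<Rightarrow> real) \<Rightarrow> ennreal" where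
  "Ap_char \<rho> \<theta> p \<omega> = (SUP (x\<^sub>0, r) \<in> UNIV \<times> {0<..}.
     ennreal ((1 + r / \<rho> x\<^sub>0) powr (- \<theta>)) *
     (if p = 1 then
        eavg (ball x\<^sub>0 r) (\<lambda>x. ennreal (\<omega> x)) *
        inverse (Liminf (ae_filter (lebesgue_on (ball x\<^sub>0 r))) (\<lambda>x. ennreal (\<omega> x)))
      else
        epow (eavg (ball x\<^sub>0 r) (\<lambda>x. ennreal (\<omega> x))) (1 / p) *
        epow (eavg (ball x\<^sub>0 r) (\<lambda>x. inverse (ennreal (\<omega> x powr (conj_exp p / p)))))
             (1 / conj_exp p)))"

definition Ap_class :: "('a::euclidean_space \<Rightarrow> real) \<Rightarrow> real \<Rightarrow> real \<Rightarrow> ('a \<Rightarrow> real) set" where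
  "Ap_class \<rho> \<theta> p = {\<omega>. weight \<omega> \<and> Ap_char \<rho> \<theta> p \<omega> < \<infinity>}"

definition Lip_norm :: "('a::euclidean_space \<Rightarrow> real) \<Rightarrow> real \<Rightarrow> real \<Rightarrow> ('a \<Rightarrow> real) \<Rightarrow> ennreal" where
  "Lip_norm \<rho> \<theta> \<beta> f = (SUP (x\<^sub>0, r) \<in> UNIV \<times> {0<..}.
     ennreal ((1 + r / \<rho> x\<^sub>0) powr (- \<theta>) *
       (1 / measure lebesgue (ball x\<^sub>0 r) powr (1 + \<beta> / DIM('a)))) *
     (\<integral>\<^sup>+x\<in>ball x\<^sub>0 r. ennreal \<bar>f x - avg (ball x\<^sub>0 r) f\<bar> \<partial>lebesgue))"

text \<open>Elements are functions rather than continuous representatives; everything below depends only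
  on the almost-everywhere class.\<close>
definition Lip_space :: "('a::euclidean_space \<Rightarrow> real) \<Rightarrow> real \<Rightarrow> real \<Rightarrow> ('a \<Rightarrow> real) set" where
  "Lip_space \<rho> \<theta> \<beta> = {f. locally_integrable f \<and> Lip_norm \<rho> \<theta> \<beta> f < \<infinity>}"

definition weighted_osc ::
    "real \<Rightarrow> real \<Rightarrow> ('a::euclidean_space \<Rightarrow> real) \<Rightarrow> ('a \<Rightarrow> real) \<Rightarrow> 'a set \<Rightarrow> ennreal" where
  "weighted_osc p \<beta> \<omega> f B =
     ennreal (1 / measure lebesgue B powr (\<beta> / DIM('a))) *
     epow ((\<integral>\<^sup>+x\<in>B. ennreal (\<bar>f x - avg B f\<bar> powr p * \<omega> x) \<partial>lebesgue) / wmeasure \<omega> B) (1 / p)"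

end

theory Submission
  imports Defs
begin

text \<open>Part (1) follows from an almost everywhere bound for \<open>|f - f\<^sub>B|\<close>. A
  function whose oscillation \<open>\<integral> |f - f\<^sub>B|\<close> over \<open>B(x, s)\<close> is at most
  \<open>H |B(x, s)|\<^bsup>1+\<beta>/d\<^esup>\<close> for every \<open>s \<le> t\<close> stays, almost everywhere, within a multiple of
  \<open>H |B(x, t)|\<^bsup>\<beta>/d\<^esup>\<close> of its average over \<open>B(x, t)\<close>: halving the radius changes the average by at
  most a term of a geometric series of ratio \<open>2\<^bsup>-\<beta>\<^esup>\<close>, and the averages reach the value of the
  function by Lebesgue differentiation (\<open>campanato_pointwise\<close>). For \<open>x\<close> in a ball
  \<open>B(x\<^sub>0, r)\<close> this is applied with \<open>t = 2r\<close>, since \<open>B(x\<^sub>0, r) \<subseteq> B(x, 2r)\<close>. The factor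
  \<open>(1 + 2r/\<rho>(x))\<^bsup>\<theta>\<^sub>1\<^esup>\<close> in \<open>H\<close> is centred at \<open>x\<close>; the lower bound in Shen's comparison
  moves it to \<open>x\<^sub>0\<close> at the price of the exponent \<open>N\<^sub>0 + 1\<close> (\<open>critical_scale_transfer\<close>). The
  resulting bound on \<open>|f - f\<^sub>B|\<close> holds almost everywhere on the ball
  (\<open>Lip_space_pointwise\<close>), so it is preserved by the weighted mean (\<open>weighted_mean_le\<close>).

  Part (2) is Hoelder's inequality. Writing \<open>|f - f\<^sub>B| = |f - f\<^sub>B| \<omega>\<^bsup>1/p\<^esup> \<omega>\<^bsup>-1/p\<^esup>\<close> gives
  a bound for the plain average of \<open>|f - f\<^sub>B|\<close> by its weighted \<open>p\<close>-mean times
  \<open>(1 + r/\<rho>(x\<^sub>0))\<^bsup>\<theta>\<^sub>2\<^esup> [\<omega>]\<close> (\<open>Ap_average_le\<close>), and the hypothesis carries exactly the factor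
  \<open>(1 + r/\<rho>(x\<^sub>0))\<^bsup>-\<theta>\<^sub>2\<^esup>\<close> that cancels the growth. The constant \<open>C'\<close> can therefore be taken
  equal to \<open>C\<close>. The factor \<open>\<omega>\<^bsup>-1/p\<^esup>\<close> and the division by \<open>\<omega>(B)\<close> make sense
  because a weight of this class vanishes only on a null set (\<open>Ap_class_pos\<close>).\<close>

section \<open>The critical radius\<close>

text \<open>A supremum in the reals may be any number when the set is empty or unbounded, so positivity of
  the critical radius has to be derived, and it follows from Shen's two bounds. The value \<open>0\<close> is excluded by the lower
  bound at \<open>y = x\<close>, since \<open>\<rho>(x) / 0 = 0\<close>. If \<open>\<rho>(x)\<close> is negative, then
  \<open>1 + |x - y| / \<rho>(x)\<close> approaches \<open>0\<close> from above as \<open>|x - y|\<close> increases to \<open>|\<rho>(x)|\<close>; the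
  lower bound then tends to infinity while the upper bound never exceeds \<open>C\<^sub>0\<close>.\<close>
lemma shen_constants_pos:
  fixes \<rho> :: "'a::euclidean_space \<Rightarrow> real"
  assumes "shen_constants \<rho> C\<^sub>0 N\<^sub>0"
  shows "0 < \<rho> x"
proof (rule ccontr)
  assume "\<not> 0 < \<rho> x"
  have C: "1 \<le> C\<^sub>0" and N: "0 < N\<^sub>0"
    and lower: "\<And>y. 1 / C\<^sub>0 * (1 + dist x y / \<rho> x) powr (- N\<^sub>0) \<le> \<rho> y / \<rho> x"
    and upper: "\<And>y. \<rho> y / \<rho> x \<le> C\<^sub>0 * (1 + dist x y / \<rho> x) powr (N\<^sub>0 / (N\<^sub>0 + 1))"
    using assms unfolding shen_constants_def by auto
  have "\<rho> x \<noteq> 0"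
    using lower[of x] C by auto
  with \<open>\<not> 0 < \<rho> x\<close> have neg: "\<rho> x < 0" by linarith
  \<comment> \<open>chosen so that the lower bound becomes twice \<open>C\<^sub>0\<close>\<close>
  define b where "b = (2 * C\<^sub>0\<^sup>2) powr (- 1 / N\<^sub>0)"
  have C2: "1 < 2 * C\<^sub>0\<^sup>2"
    using C one_le_power[of C\<^sub>0 2] by linarith
  have b: "0 < b" "b < 1"
    using C2 N by (auto simp: b_def powr_less_one divide_neg_pos)
  obtain e :: 'a where e: "e \<in> Basis" by (meson nonempty_Basis ex_in_conv)
  define y where "y = x + (\<bar>\<rho> x\<bar> * (1 - b)) *\<^sub>R e"
  have "dist x y = \<bar>\<rho> x\<bar> * (1 - b)"
    using b e by (simp add: y_def dist_norm abs_mult)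
  then have eq: "1 + dist x y / \<rho> x = b"
    using neg by (simp add: field_simps)
  have "b powr (- N\<^sub>0) = 2 * C\<^sub>0\<^sup>2"
    using N C2 by (simp add: b_def powr_powr)
  moreover have "b powr (N\<^sub>0 / (N\<^sub>0 + 1)) \<le> 1"
    using b N by (intro powr_le1) auto
  ultimately have "C\<^sub>0 * b powr (N\<^sub>0 / (N\<^sub>0 + 1)) \<le> C\<^sub>0" "1 / C\<^sub>0 * b powr (- N\<^sub>0) = 2 * C\<^sub>0"
    using C by (simp_all add: power2_eq_square)
  then show False
    using lower[of y] upper[of y] C unfolding eq by linarith
qed

text \<open>The source of the exponent \<open>N\<^sub>0 + 1\<close>: the critical radius can shrink at most by the factor
  \<open>C\<^sub>0 (1 + r/\<rho>(x))\<^bsup>N\<^sub>0\<^esup>\<close> over a distance \<open>r\<close>, and \<open>r/\<rho>(x)\<close> contributes one more power.\<close>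
lemma critical_scale_transfer:
  fixes \<rho> :: "'a::euclidean_space \<Rightarrow> real"
  assumes shen: "shen_constants \<rho> C\<^sub>0 N\<^sub>0" and "0 < r" and xy: "dist x y \<le> r"
  shows "1 + 2 * r / \<rho> y \<le> 2 * C\<^sub>0 * (1 + r / \<rho> x) powr (N\<^sub>0 + 1)"
proof -
  have C: "1 \<le> C\<^sub>0" and N: "0 < N\<^sub>0"
    and low: "1 / C\<^sub>0 * (1 + dist x y / \<rho> x) powr (- N\<^sub>0) \<le> \<rho> y / \<rho> x"
    using shen unfolding shen_constants_def by auto
  have px: "0 < \<rho> x" and py: "0 < \<rho> y"
    using shen_constants_pos[OF shen] by auto
  define u where "u = r / \<rho> x"
  have u: "0 < u" using \<open>0 < r\<close> px by (simp add: u_def)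
  have "(1 + dist x y / \<rho> x) powr N\<^sub>0 \<le> (1 + u) powr N\<^sub>0"
    using xy px N u by (intro powr_mono2) (auto simp: u_def divide_right_mono)
  then have D: "(1 + u) powr (- N\<^sub>0) \<le> (1 + dist x y / \<rho> x) powr (- N\<^sub>0)"
    using px by (auto simp: powr_minus add_nonneg_eq_0_iff intro!: le_imp_inverse_le)
  have "1 / C\<^sub>0 * (1 + u) powr (- N\<^sub>0) \<le> \<rho> y / \<rho> x"
    using low mult_left_mono[OF D, of "1 / C\<^sub>0"] C by simp
  then have "\<rho> x / \<rho> y \<le> C\<^sub>0 * (1 + u) powr N\<^sub>0"
    using C px py u by (simp add: powr_minus field_simps)
  then have "u * (\<rho> x / \<rho> y) \<le> u * (C\<^sub>0 * (1 + u) powr N\<^sub>0)"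
    using u by (intro mult_left_mono) auto
  then have "r / \<rho> y \<le> C\<^sub>0 * (u * (1 + u) powr N\<^sub>0)"
    using px by (simp add: u_def mult_ac)
  moreover have "1 \<le> C\<^sub>0 * (1 + u) powr N\<^sub>0"
    using C u N ge_one_powr_ge_zero[of "1 + u" N\<^sub>0] mult_mono[of 1 C\<^sub>0 1 "(1 + u) powr N\<^sub>0"] by auto
  ultimately have "1 + 2 * (r / \<rho> y) \<le> 2 * (C\<^sub>0 * (1 + u) powr N\<^sub>0) + 2 * (C\<^sub>0 * (u * (1 + u) powr N\<^sub>0))"
    by linarith
  also have "\<dots> = 2 * C\<^sub>0 * ((1 + u) powr N\<^sub>0 * (1 + u))"
    by (simp add: algebra_simps)
  also have "\<dots> = 2 * C\<^sub>0 * (1 + u) powr (N\<^sub>0 + 1)"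
    using u by (simp add: powr_add)
  finally show ?thesis
    by (simp add: u_def)
qed

section \<open>Averages and oscillation\<close>
lemma locally_integrable_set_integrable:
  fixes f :: "'a::euclidean_space \<Rightarrow> real"
  assumes f: "locally_integrable f" and S: "bounded S" "S \<in> sets lebesgue"
  shows "set_integrable lebesgue S f"
proof -
  obtain R where "S \<subseteq> cball 0 R"
    using S(1) by (auto simp: bounded_iff subset_eq)
  moreover have "set_integrable lebesgue (cball 0 R) f"
    using f unfolding locally_integrable_def by auto
  ultimately show ?thesis
    using set_integrable_subset S(2) by blast
qed

lemma locally_integrable_measurable:
  fixes f :: "'a::euclidean_space \<Rightarrow> real"
  assumes f: "locally_integrable f"
  shows "f \<in> borel_measurable lebesgue"
proof (rule borel_measurable_LIMSEQ_real)
  fix n :: nat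
  show "(\<lambda>x. indicat_real (cball 0 (real n)) x * f x) \<in> borel_measurable lebesgue"
    using locally_integrable_set_integrable[OF f, of "cball 0 (real n)"]
    unfolding set_integrable_def by auto
next
  fix x :: 'a
  obtain N where N: "norm x \<le> real N" using real_arch_simple by blast
  have "\<forall>n\<ge>N. indicat_real (cball 0 (real n)) x * f x = f x"
    using N by (auto simp: indicator_def)
  then show "(\<lambda>n. indicat_real (cball 0 (real n)) x * f x) \<longlonglongrightarrow> f x"
    by (intro tendsto_eventually) (auto simp: eventually_sequentially)
qed

lemma locally_integrable_diff_const:
  fixes f :: "'a::euclidean_space \<Rightarrow> real"
  assumes f: "locally_integrable f" and S: "bounded S" "S \<in> sets lebesgue"
  shows "set_integrable lebesgue S (\<lambda>x. f x - c)"
proof -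
  have "S \<in> lmeasurable"
    using S bounded_set_imp_lmeasurable by blast
  then have "set_integrable lebesgue S (\<lambda>x. c)"
    unfolding set_integrable_def by (auto simp: fmeasurable_def)
  then show ?thesis
    using locally_integrable_set_integrable[OF f S] by auto
qed

lemma nn_integral_abs_diff:
  fixes f :: "'a::euclidean_space \<Rightarrow> real"
  assumes f: "locally_integrable f" and S: "bounded S" "S \<in> sets lebesgue"
  shows "(\<integral>\<^sup>+x\<in>S. ennreal \<bar>f x - c\<bar> \<partial>lebesgue) = ennreal (LINT x:S|lebesgue. \<bar>f x - c\<bar>)"
proof -
  have "set_integrable lebesgue S (\<lambda>x. \<bar>f x - c\<bar>)"
    using set_integrable_abs[OF locally_integrable_diff_const[OF f S]] by simp
  then have "(\<integral>\<^sup>+x. ennreal (indicat_real S x *\<^sub>R \<bar>f x - c\<bar>) \<partial>lebesgue) =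
      ennreal (LINT x:S|lebesgue. \<bar>f x - c\<bar>)"
    unfolding set_integrable_def set_lebesgue_integral_def
    by (intro nn_integral_eq_integral) (auto)
  moreover have "(\<integral>\<^sup>+x\<in>S. ennreal \<bar>f x - c\<bar> \<partial>lebesgue) =
      (\<integral>\<^sup>+x. ennreal (indicat_real S x *\<^sub>R \<bar>f x - c\<bar>) \<partial>lebesgue)"
    by (intro nn_integral_cong) (auto simp: indicator_def)
  ultimately show ?thesis by simp
qed

text \<open>With \<open>c\<close> the average over \<open>B\<close>, passing to a subset of comparable measure moves the average by
  no more than a multiple of the mean oscillation. This is the single step of every chain below.\<close>
lemma avg_diff_le:
  fixes f :: "'a::euclidean_space \<Rightarrow> real"
  assumes f: "locally_integrable f" and B: "bounded B" "B \<in> sets lebesgue"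
    and S: "S \<subseteq> B" "S \<in> sets lebesgue" "0 < measure lebesgue S"
  shows "\<bar>avg S f - c\<bar> \<le> (LINT x:B|lebesgue. \<bar>f x - c\<bar>) / measure lebesgue S"
proof -
  have bS: "bounded S" using B S bounded_subset by blast
  note iS = locally_integrable_diff_const[OF f bS S(2)]
  note iB = set_integrable_abs[OF locally_integrable_diff_const[OF f B]]
  have lm: "S \<in> lmeasurable" using bS S(2) bounded_set_imp_lmeasurable by blast
  have cS: "set_integrable lebesgue S (\<lambda>x. c)"
    using lm unfolding set_integrable_def by (auto simp: fmeasurable_def)
  have "(LINT x:S|lebesgue. f x - c) = (LINT x:S|lebesgue. f x) - (LINT x:S|lebesgue. c)"
    using locally_integrable_set_integrable[OF f bS S(2)] cS by simp
  also have "(LINT x:S|lebesgue. c) = c * measure lebesgue S"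
    using lm by (simp add: set_lebesgue_integral_def)
  finally have "avg S f - c = (LINT x:S|lebesgue. f x - c) / measure lebesgue S"
    using S(3) by (simp add: avg_def field_simps)
  moreover have "\<bar>LINT x:S|lebesgue. f x - c\<bar> \<le> (LINT x:S|lebesgue. \<bar>f x - c\<bar>)"
    using set_integral_norm_bound[OF iS] by simp
  moreover have "(LINT x:S|lebesgue. \<bar>f x - c\<bar>) \<le> (LINT x:B|lebesgue. \<bar>f x - c\<bar>)"
    using iB set_integrable_subset[OF iB S(2,1)] S(1) unfolding set_lebesgue_integral_def set_integrable_def
    by (intro integral_mono) (auto simp: indicator_def)
  ultimately show ?thesis
    using S(3) by (simp add: abs_div divide_right_mono)
qed

text \<open>The cubes have \<open>x\<close> as a corner. Each of them lies in a ball around \<open>x\<close> of comparable measure,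
  which is how differentiation enters the chain of balls below.\<close>
lemma lebesgue_differentiation_cubes:
  fixes f :: "'a::euclidean_space \<Rightarrow> real"
  assumes f: "locally_integrable f" and h: "h \<longlonglongrightarrow> 0" "\<And>n. 0 < h n"
  shows "AE x in lebesgue. (\<lambda>n. avg (cbox x (x + h n *\<^sub>R One)) f) \<longlonglongrightarrow> f x"
proof -
  have si: "set_integrable lebesgue (cbox a b) f" for a b
    by (rule locally_integrable_set_integrable[OF f]) auto
  then have "f integrable_on cbox a b" for a b
    using set_lebesgue_integral_eq_integral(1) by blast
  then obtain N where N: "negligible N"
    and diff: "\<And>x e. \<lbrakk>x \<notin> N; 0 < e\<rbrakk> \<Longrightarrow> \<exists>d>0. \<forall>h. 0 < h \<and> h < d \<longrightarrow>
                norm (integral (cbox x (x + h *\<^sub>R One)) f /\<^sub>R h ^ DIM('a) - f x) < e"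
    using integrable_ccontinuous_explicit[of f] by blast
  have avg_eq: "avg (cbox x (x + t *\<^sub>R One)) f = integral (cbox x (x + t *\<^sub>R One)) f /\<^sub>R t ^ DIM('a)"
    if "0 < t" for x t
  proof -
    have "(LINT y:cbox x (x + t *\<^sub>R One)|lebesgue. f y) = integral (cbox x (x + t *\<^sub>R One)) f"
      using set_lebesgue_integral_eq_integral(2)[OF si] .
    moreover have "measure lebesgue (cbox x (x + t *\<^sub>R One)) = t ^ DIM('a)"
      using that content_cbox_plus[of x t] by simp
    ultimately show ?thesis
      by (simp add: avg_def divide_inverse mult.commute)
  qed
  have "(\<lambda>n. avg (cbox x (x + h n *\<^sub>R One)) f) \<longlonglongrightarrow> f x" if x: "x \<notin> N" for x
  proof (rule tendstoI)
    fix e :: real assume "0 < e"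
    then obtain d where "0 < d" and d: "\<And>t. 0 < t \<Longrightarrow> t < d \<Longrightarrow>
        norm (integral (cbox x (x + t *\<^sub>R One)) f /\<^sub>R t ^ DIM('a) - f x) < e"
      using diff[OF x \<open>0 < e\<close>] by blast
    have "eventually (\<lambda>n. h n < d) sequentially"
      using h(1) \<open>0 < d\<close> by (rule order_tendstoD)
    then show "eventually (\<lambda>n. dist (avg (cbox x (x + h n *\<^sub>R One)) f) (f x) < e) sequentially"
      by eventually_elim (use d h(2) avg_eq in \<open>auto simp: dist_norm\<close>)
  qed
  then show ?thesis
    using N unfolding negligible_iff_null_sets by (intro AE_I') auto
qed

section \<open>From mean oscillation to pointwise bounds\<close>
lemma Lip_space_oscillation:
  fixes f :: "'a::euclidean_space \<Rightarrow> real"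
  assumes f: "f \<in> Lip_space \<rho> \<theta> \<beta>" and "0 < r" and \<rho>: "0 < \<rho> x"
  shows "(LINT y:ball x r|lebesgue. \<bar>f y - avg (ball x r) f\<bar>) \<le>
    enn2real (Lip_norm \<rho> \<theta> \<beta> f) * (1 + r / \<rho> x) powr \<theta> *
      measure lebesgue (ball x r) powr (1 + \<beta> / DIM('a))"
proof -
  have li: "locally_integrable f" and fin: "Lip_norm \<rho> \<theta> \<beta> f < \<infinity>"
    using f by (auto simp: Lip_space_def)
  define I where "I = (LINT y:ball x r|lebesgue. \<bar>f y - avg (ball x r) f\<bar>)"
  define v where "v = measure lebesgue (ball x r) powr (1 + \<beta> / DIM('a))"
  define k where "k = (1 + r / \<rho> x) powr \<theta>"
  have v: "0 < v" using content_ball_pos[OF \<open>0 < r\<close>, of x] by (simp add: v_def)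
  have k: "0 < k" using \<open>0 < r\<close> \<rho> by (simp add: k_def add_pos_pos less_imp_neq[symmetric])
  have "ennreal ((1 + r / \<rho> x) powr (- \<theta>) * (1 / v)) *
      (\<integral>\<^sup>+y\<in>ball x r. ennreal \<bar>f y - avg (ball x r) f\<bar> \<partial>lebesgue) \<le> Lip_norm \<rho> \<theta> \<beta> f"
    unfolding Lip_norm_def v_def using \<open>0 < r\<close> by (intro SUP_upper2[where i="(x, r)"]) auto
  also have "(\<integral>\<^sup>+y\<in>ball x r. ennreal \<bar>f y - avg (ball x r) f\<bar> \<partial>lebesgue) = ennreal I"
    unfolding I_def by (rule nn_integral_abs_diff[OF li]) auto
  also have "(1 + r / \<rho> x) powr (- \<theta>) * (1 / v) = 1 / (k * v)"
    by (simp add: k_def powr_minus field_simps)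
  also have "Lip_norm \<rho> \<theta> \<beta> f = ennreal (enn2real (Lip_norm \<rho> \<theta> \<beta> f))"
    using fin by simp
  finally have "1 / (k * v) * I \<le> enn2real (Lip_norm \<rho> \<theta> \<beta> f)"
    using k v by (subst (asm) ennreal_mult'[symmetric]) (auto simp: ennreal_le_iff)
  then show ?thesis
    using k v unfolding I_def[symmetric] k_def[symmetric] v_def[symmetric]
    by (simp add: field_simps)
qed

lemma measure_ball_scale:
  fixes x y :: "'a::euclidean_space"
  assumes "0 \<le> c" "0 \<le> r"
  shows "measure lebesgue (ball x (c * r)) = c ^ DIM('a) * measure lebesgue (ball y r)"
  using assms by (simp add: content_ball power_mult_distrib)

text \<open>The exponent \<open>\<beta>/d\<close> turns the volume factor \<open>c\<^sup>d\<close> of a dilation by \<open>c\<close> into \<open>c\<^bsup>\<beta>\<^esup>\<close>.\<close>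
lemma powr_dimension_scale:
  assumes "0 \<le> c" "0 \<le> v" "0 < d"
  shows "(c ^ d * v) powr (\<beta> / real d) = c powr \<beta> * v powr (\<beta> / real d)"
proof (cases "c = 0")
  case False
  then have "(c ^ d) powr (\<beta> / real d) = c powr \<beta>"
    using assms by (simp flip: powr_realpow add: powr_powr)
  then show ?thesis using assms by (simp add: powr_mult)
qed (use assms in auto)

text \<open>The first summand is the geometric series of the halving steps, each losing the volume ratio
  \<open>2\<^sup>d\<close>; the second is the volume ratio of \<open>B(x, s)\<close> to a cube of side \<open>s/(2d)\<close>, for the passage
  from balls to cubes.\<close>
definition campanato_const :: "nat \<Rightarrow> real \<Rightarrow> real" where
  "campanato_const d \<beta> = 2 ^ d / (1 - 2 powr - \<beta>) + unit_ball_vol d * (2 * d) ^ d"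

lemma campanato_const_nonneg: "0 < \<beta> \<Longrightarrow> 0 \<le> campanato_const d \<beta>"
  by (auto simp: campanato_const_def powr_less_one intro!: add_nonneg_nonneg divide_nonneg_pos)

text \<open>Telescoping over the balls \<open>B(x, t/2\<^sup>n)\<close> bounds the drift of the averages uniformly in \<open>n\<close>. The
  last step goes from the small ball to a cube inside it, whose averages tend to \<open>f x\<close>; there a
  bound uniform in \<open>n\<close> suffices, although the difference even tends to \<open>0\<close>.\<close>
lemma campanato_pointwise:
  fixes f :: "'a::euclidean_space \<Rightarrow> real"
  assumes f: "locally_integrable f" and t: "0 < t" and H: "0 \<le> H" and \<beta>: "0 < \<beta>"
    and osc: "\<And>s. 0 < s \<Longrightarrow> s \<le> t \<Longrightarrow>
      (LINT y:ball x s|lebesgue. \<bar>f y - avg (ball x s) f\<bar>) \<le>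
        H * measure lebesgue (ball x s) powr (1 + \<beta> / DIM('a))"
    and lim: "(\<lambda>n. avg (cbox x (x + (t / 2 ^ n / (2 * DIM('a))) *\<^sub>R One)) f) \<longlonglongrightarrow> f x"
  shows "\<bar>f x - avg (ball x t) f\<bar> \<le>
    campanato_const DIM('a) \<beta> * H * measure lebesgue (ball x t) powr (\<beta> / DIM('a))"
proof -
  define d where "d = DIM('a)"
  define q where "q = 2 powr - \<beta>"
  define v where "v s = measure lebesgue (ball x s)" for s
  define A where "A = v t powr (\<beta> / d)"
  define B where "B n = ball x (t / 2 ^ n)" for n :: nat
  define Q where "Q n = cbox x (x + (t / 2 ^ n / (2 * d)) *\<^sub>R One)" for n :: nat
  have d: "0 < d" by (simp add: d_def)
  have q: "0 < q" "q < 1" using \<beta> by (auto simp: q_def powr_less_one)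
  have tn: "0 < t / 2 ^ n" "t / 2 ^ n \<le> t" for n :: nat
    using t by (auto simp: field_simps)
  have vpos: "0 < v (t / 2 ^ n)" for n :: nat
    unfolding v_def using tn by (simp add: content_ball_pos)
  have A: "0 \<le> A" by (simp add: A_def)
  have vpow: "v (t / 2 ^ n) powr (\<beta> / d) = q ^ n * A" for n
  proof -
    have "v (t / 2 ^ n) = (1 / 2 ^ n) ^ d * v t"
      using measure_ball_scale[of "1 / 2 ^ n" t x x] t by (simp add: v_def d_def)
    then have "v (t / 2 ^ n) powr (\<beta> / d) = (1 / 2 ^ n) powr \<beta> * A"
      using d vpos[of 0] powr_dimension_scale[of "1 / 2 ^ n" "v t" d \<beta>] by (simp add: A_def)
    also have "(1 / 2 ^ n) powr \<beta> = q ^ n"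
    proof -
      have "(1 / 2 ^ n :: real) = 2 powr (- real n)"
        by (simp add: powr_minus powr_realpow field_simps)
      then have "(1 / 2 ^ n) powr \<beta> = 2 powr (- \<beta> * real n)"
        by (simp add: powr_powr mult.commute)
      also have "\<dots> = q ^ n"
        unfolding q_def by (simp only: powr_powr[symmetric] powr_realpow[OF powr_gt_zero[THEN iffD2]])
      finally show ?thesis .
    qed
    finally show ?thesis .
  qed
  have oscB: "(LINT y:B n|lebesgue. \<bar>f y - avg (B n) f\<bar>) \<le> v (t / 2 ^ n) * (H * (q ^ n * A))" for n
  proof -
    have "(LINT y:B n|lebesgue. \<bar>f y - avg (B n) f\<bar>) \<le> H * v (t / 2 ^ n) powr (1 + \<beta> / d)"
      unfolding B_def v_def d_def by (rule osc[OF tn])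
    also have "v (t / 2 ^ n) powr (1 + \<beta> / d) = v (t / 2 ^ n) * (q ^ n * A)"
      using vpos[of n] by (simp add: powr_add vpow)
    finally show ?thesis by (simp add: mult_ac)
  qed
  have sub_bound: "\<bar>avg S f - avg (B n) f\<bar> \<le> k * (H * (q ^ n * A))"
    if S: "S \<subseteq> B n" "S \<in> sets lebesgue" and vS: "v (t / 2 ^ n) = k * measure lebesgue S" and k: "0 < k"
    for S n k
  proof -
    have "0 < measure lebesgue S"
      using vpos[of n] k unfolding vS by (simp add: zero_less_mult_iff)
    moreover from this have "\<bar>avg S f - avg (B n) f\<bar> \<le>
        (LINT y:B n|lebesgue. \<bar>f y - avg (B n) f\<bar>) / measure lebesgue S"
      using S by (intro avg_diff_le[OF f]) (auto simp: B_def)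
    moreover have "(LINT y:B n|lebesgue. \<bar>f y - avg (B n) f\<bar>) / measure lebesgue S \<le>
        k * measure lebesgue S * (H * (q ^ n * A)) / measure lebesgue S"
      using oscB[of n] unfolding vS by (rule divide_right_mono) simp
    ultimately show ?thesis by simp
  qed
  \<comment> \<open>the sum of the geometric series of steps\<close>
  define E where "E = 2 ^ d * H * A / (1 - q)"
  have E: "0 \<le> E" using q H A by (simp add: E_def)
  have step: "\<bar>avg (B (Suc n)) f - avg (B n) f\<bar> \<le> E * (1 - q) * q ^ n" for n
  proof -
    have "v (t / 2 ^ n) = 2 ^ d * measure lebesgue (B (Suc n))"
      using measure_ball_scale[of 2 "t / 2 ^ Suc n" x x] t by (simp add: v_def d_def B_def)
    moreover have "B (Suc n) \<subseteq> B n"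
      unfolding B_def using t by (intro subset_ball) (simp add: field_simps)
    ultimately have "\<bar>avg (B (Suc n)) f - avg (B n) f\<bar> \<le> 2 ^ d * (H * (q ^ n * A))"
      by (intro sub_bound) (auto simp: B_def)
    then show ?thesis using q by (simp add: E_def mult_ac)
  qed
  have chain: "\<bar>avg (B n) f - avg (B 0) f\<bar> \<le> E * (1 - q ^ n)" for n
  proof (induction n)
    case (Suc n)
    have "E * (1 - q ^ Suc n) = E * (1 - q ^ n) + E * (1 - q) * q ^ n"
      by (simp add: algebra_simps)
    then show ?case using Suc step[of n] by linarith
  qed simp
  define G where "G = unit_ball_vol d * (2 * d) ^ d * H * A"
  have cube: "\<bar>avg (Q n) f - avg (B n) f\<bar> \<le> G" for n
  proof -
    \<comment> \<open>side \<open>s/(2d)\<close> gives diagonal at most \<open>s/2\<close>, so the cube lies in the open ball\<close>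
    define h where "h = t / 2 ^ n / (2 * d)"
    have h: "0 < h" using tn[of n] d by (simp add: h_def)
    have hd: "h * (2 * d) = t / 2 ^ n" using d by (simp add: h_def)
    have "Q n \<subseteq> B n"
    proof
      fix y assume y: "y \<in> Q n"
      have "norm (y - x) \<le> (\<Sum>i\<in>Basis. \<bar>(y - x) \<bullet> i\<bar>)" by (rule norm_le_l1)
      also have "\<dots> \<le> (\<Sum>i\<in>(Basis :: 'a set). h)"
        using y by (intro sum_mono) (auto simp: Q_def h_def mem_box algebra_simps)
      also have "\<dots> = d * h" by (simp add: d_def)
      also have "\<dots> < t / 2 ^ n" using h d by (simp flip: hd)
      finally show "y \<in> B n" by (simp add: B_def dist_norm norm_minus_commute)
    qed
    moreover have "v (t / 2 ^ n) = unit_ball_vol d * (2 * d) ^ d * measure lebesgue (Q n)"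
    proof -
      have "measure lebesgue (Q n) = h ^ d"
        using h content_cbox_plus[of x h] by (simp add: Q_def h_def d_def)
      moreover have "v (t / 2 ^ n) = unit_ball_vol d * (h * (2 * d)) ^ d"
        using tn[of n] unfolding hd by (simp add: v_def d_def content_ball)
      ultimately show ?thesis by (simp add: power_mult_distrib mult_ac)
    qed
    ultimately have "\<bar>avg (Q n) f - avg (B n) f\<bar> \<le>
        unit_ball_vol d * (2 * d) ^ d * (H * (q ^ n * A))"
      using d by (intro sub_bound) (auto simp: Q_def)
    also have "\<dots> = G * q ^ n" by (simp add: G_def mult_ac)
    also have "\<dots> \<le> G * 1"
      using q H A by (intro mult_left_mono power_le_one) (auto simp: G_def)
    finally show ?thesis by simp
  qed
  have "\<bar>avg (Q n) f - avg (B 0) f\<bar> \<le> E + G" for n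
  proof -
    have "E * (1 - q ^ n) \<le> E * 1" using E q by (intro mult_left_mono) auto
    then show ?thesis using cube[of n] chain[of n] by linarith
  qed
  moreover have "(\<lambda>n. \<bar>avg (Q n) f - avg (B 0) f\<bar>) \<longlonglongrightarrow> \<bar>f x - avg (B 0) f\<bar>"
    using lim by (intro tendsto_intros) (simp add: Q_def d_def)
  ultimately have "\<bar>f x - avg (B 0) f\<bar> \<le> E + G"
    by (intro LIMSEQ_le_const2) auto
  also have "E + G = campanato_const d \<beta> * H * A"
    by (simp add: E_def G_def campanato_const_def q_def algebra_simps)
  finally show ?thesis by (simp add: B_def A_def v_def d_def)
qed

text \<open>The chain is run around each point \<open>x\<close> of the ball rather than around \<open>x\<^sub>0\<close>, because
  differentiation needs balls that shrink to \<open>x\<close>.\<close>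
lemma Lip_space_pointwise:
  fixes f :: "'a::euclidean_space \<Rightarrow> real"
  assumes shen: "shen_constants \<rho> C\<^sub>0 N\<^sub>0" and f: "f \<in> Lip_space \<rho> \<theta> \<beta>"
    and r: "0 < r" and \<beta>: "0 < \<beta>" and \<theta>: "0 \<le> \<theta>"
  shows "AE x in lebesgue. x \<in> ball x\<^sub>0 r \<longrightarrow> \<bar>f x - avg (ball x\<^sub>0 r) f\<bar> \<le>
    (campanato_const DIM('a) \<beta> + 2 ^ DIM('a)) * 2 powr \<beta> * (2 * C\<^sub>0) powr \<theta> *
      (1 + r / \<rho> x\<^sub>0) powr ((N\<^sub>0 + 1) * \<theta>) * enn2real (Lip_norm \<rho> \<theta> \<beta> f) *
      measure lebesgue (ball x\<^sub>0 r) powr (\<beta> / DIM('a))"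
proof -
  define d where "d = DIM('a)"
  define M where "M = enn2real (Lip_norm \<rho> \<theta> \<beta> f)"
  define K where "K = campanato_const d \<beta>"
  define v where "v = measure lebesgue (ball x\<^sub>0 r)"
  have M: "0 \<le> M" and K: "0 \<le> K" and v: "0 < v"
    using r \<beta> by (auto simp: M_def K_def v_def campanato_const_nonneg content_ball_pos)
  have li: "locally_integrable f" using f by (simp add: Lip_space_def)
  have \<rho>: "0 < \<rho> x" for x using shen_constants_pos[OF shen] .
  have C: "1 \<le> C\<^sub>0" using shen by (simp add: shen_constants_def)
  have "(\<lambda>n. 2 * r / 2 ^ n / (2 * d)) \<longlonglongrightarrow> 0"
  proof -
    have "(\<lambda>n. r / d * (1 / 2) ^ n) \<longlonglongrightarrow> r / d * 0"
      by (intro tendsto_intros LIMSEQ_power_zero) auto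
    then show ?thesis by (simp add: power_one_over field_simps)
  qed
  then have "AE x in lebesgue. (\<lambda>n. avg (cbox x (x + (2 * r / 2 ^ n / (2 * d)) *\<^sub>R One)) f) \<longlonglongrightarrow> f x"
    using r by (intro lebesgue_differentiation_cubes[OF li]) (auto simp: d_def)
  then show ?thesis
  proof (eventually_elim, intro impI)
    fix x assume lim: "(\<lambda>n. avg (cbox x (x + (2 * r / 2 ^ n / (2 * d)) *\<^sub>R One)) f) \<longlonglongrightarrow> f x"
      and x: "x \<in> ball x\<^sub>0 r"
    define H where "H = M * (1 + 2 * r / \<rho> x) powr \<theta>"
    have H: "0 \<le> H" using M by (simp add: H_def)
    have osc: "(LINT y:ball x s|lebesgue. \<bar>f y - avg (ball x s) f\<bar>) \<le>
        H * measure lebesgue (ball x s) powr (1 + \<beta> / d)" if s: "0 < s" "s \<le> 2 * r" for s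
    proof -
      have "(1 + s / \<rho> x) powr \<theta> \<le> (1 + 2 * r / \<rho> x) powr \<theta>"
        using s \<rho>[of x] \<theta> by (intro powr_mono2) (auto simp: divide_right_mono)
      then have "M * (1 + s / \<rho> x) powr \<theta> * measure lebesgue (ball x s) powr (1 + \<beta> / d) \<le>
          H * measure lebesgue (ball x s) powr (1 + \<beta> / d)"
        using M unfolding H_def by (intro mult_right_mono mult_left_mono) auto
      then show ?thesis
        using Lip_space_oscillation[OF f s(1) \<rho>[of x]] unfolding M_def d_def by linarith
    qed
    have v2: "measure lebesgue (ball x (2 * r)) = 2 ^ d * v"
      using measure_ball_scale[of 2 r x x\<^sub>0] r by (simp add: v_def d_def)
    have v2p: "(2 ^ d * v) powr (\<beta> / d) = 2 powr \<beta> * v powr (\<beta> / d)"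
      using v by (intro powr_dimension_scale) (auto simp: d_def)
    have "\<bar>f x - avg (ball x (2 * r)) f\<bar> \<le> K * H * (2 powr \<beta> * v powr (\<beta> / d))"
      using campanato_pointwise[OF li _ H \<beta>, of "2 * r" x] r osc lim
      by (simp add: K_def d_def[symmetric] v2 v2p)
    moreover have "\<bar>avg (ball x\<^sub>0 r) f - avg (ball x (2 * r)) f\<bar> \<le> 2 ^ d * H * (2 powr \<beta> * v powr (\<beta> / d))"
    proof -
      have "ball x\<^sub>0 r \<subseteq> ball x (2 * r)"
        using x by (intro ball_subset_ball_iff[THEN iffD2]) (auto simp: dist_commute)
      then have "\<bar>avg (ball x\<^sub>0 r) f - avg (ball x (2 * r)) f\<bar> \<le>
          (LINT y:ball x (2 * r)|lebesgue. \<bar>f y - avg (ball x (2 * r)) f\<bar>) / v"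
        using v unfolding v_def by (intro avg_diff_le[OF li]) auto
      also have "\<dots> \<le> H * (2 ^ d * v) powr (1 + \<beta> / d) / v"
        using osc[of "2 * r"] r v by (simp add: v2 divide_right_mono)
      also have "\<dots> = 2 ^ d * H * (2 powr \<beta> * v powr (\<beta> / d))"
        using v by (simp add: powr_add v2p)
      finally show ?thesis .
    qed
    ultimately have "\<bar>f x - avg (ball x\<^sub>0 r) f\<bar> \<le> (K + 2 ^ d) * H * (2 powr \<beta> * v powr (\<beta> / d))"
      by (simp add: distrib_right)
    also have "\<dots> \<le> (K + 2 ^ d) * (M * ((2 * C\<^sub>0) powr \<theta> * (1 + r / \<rho> x\<^sub>0) powr ((N\<^sub>0 + 1) * \<theta>))) *
        (2 powr \<beta> * v powr (\<beta> / d))"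
    proof -
      have "(1 + 2 * r / \<rho> x) powr \<theta> \<le> (2 * C\<^sub>0 * (1 + r / \<rho> x\<^sub>0) powr (N\<^sub>0 + 1)) powr \<theta>"
        using critical_scale_transfer[OF shen r, of x\<^sub>0 x] x \<theta> r \<rho>[of x] by (intro powr_mono2) auto
      also have "\<dots> = (2 * C\<^sub>0) powr \<theta> * (1 + r / \<rho> x\<^sub>0) powr ((N\<^sub>0 + 1) * \<theta>)"
        using C by (simp add: powr_mult powr_powr)
      finally show ?thesis
        using M K unfolding H_def by (intro mult_right_mono mult_left_mono) auto
    qed
    finally show "\<bar>f x - avg (ball x\<^sub>0 r) f\<bar> \<le>
      (campanato_const DIM('a) \<beta> + 2 ^ DIM('a)) * 2 powr \<beta> * (2 * C\<^sub>0) powr \<theta> *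
        (1 + r / \<rho> x\<^sub>0) powr ((N\<^sub>0 + 1) * \<theta>) * enn2real (Lip_norm \<rho> \<theta> \<beta> f) *
        measure lebesgue (ball x\<^sub>0 r) powr (\<beta> / DIM('a))"
      by (simp add: K_def M_def v_def d_def mult_ac)
  qed
qed

section \<open>Weighted oscillation of a bounded deviation\<close>
lemma epow_ennreal: "0 \<le> a \<Longrightarrow> epow (ennreal a) t = ennreal (a powr t)"
  by (simp add: epow_def)

lemma epow_mono:
  assumes "a \<le> b" "0 \<le> t"
  shows "epow a t \<le> epow b t"
proof (cases b)
  case (real b')
  then obtain a' where "a = ennreal a'" "0 \<le> a'" "a' \<le> b'"
    using assms(1) by (cases a) (auto simp: top_unique)
  then show ?thesis
    using real assms(2) by (simp add: epow_ennreal powr_mono2 ennreal_leI)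
qed (simp add: epow_def)

lemma weight_measurable: "weight \<omega> \<Longrightarrow> \<omega> \<in> borel_measurable lebesgue"
  by (simp add: weight_def locally_integrable_measurable)

lemma wmeasure_ball_finite:
  assumes "weight \<omega>"
  shows "wmeasure \<omega> (ball x r) < \<infinity>"
proof -
  have "locally_integrable \<omega>" and "\<And>x. 0 \<le> \<omega> x"
    using assms by (auto simp: weight_def)
  then have "wmeasure \<omega> (ball x r) = (\<integral>\<^sup>+y\<in>ball x r. ennreal \<bar>\<omega> y - 0\<bar> \<partial>lebesgue)"
    by (simp add: wmeasure_def)
  also have "\<dots> = ennreal (LINT y:ball x r|lebesgue. \<bar>\<omega> y - 0\<bar>)"
    using \<open>locally_integrable \<omega>\<close> by (intro nn_integral_abs_diff) auto
  finally show ?thesis by simp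
qed

text \<open>A weighted mean of values at most \<open>L\<close> is at most \<open>L\<close>. If \<open>\<omega>(B) = 0\<close>, the quotient is \<open>0 / 0\<close>,
  which is \<open>0\<close> in the extended nonnegative reals, and the bound persists.\<close>
lemma weighted_mean_le:
  fixes f :: "'a::euclidean_space \<Rightarrow> real"
  assumes \<omega>: "weight \<omega>" and p: "0 < p" and L: "0 \<le> L"
    and bound: "AE x in lebesgue. x \<in> ball x\<^sub>0 r \<longrightarrow> \<bar>f x - avg (ball x\<^sub>0 r) f\<bar> \<le> L"
  shows "weighted_osc p \<beta> \<omega> f (ball x\<^sub>0 r) \<le>
    ennreal (L / measure lebesgue (ball x\<^sub>0 r) powr (\<beta> / DIM('a)))"
proof -
  let ?B = "ball x\<^sub>0 r"
  have pos: "0 \<le> \<omega> x" for x using \<omega> by (simp add: weight_def)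
  have [measurable]: "\<omega> \<in> borel_measurable lebesgue" by (rule weight_measurable[OF \<omega>])
  have [measurable]: "?B \<in> sets lebesgue" by auto
  define w where "w = wmeasure \<omega> ?B"
  have "(\<integral>\<^sup>+x\<in>?B. ennreal (\<bar>f x - avg ?B f\<bar> powr p * \<omega> x) \<partial>lebesgue) \<le>
      (\<integral>\<^sup>+x. ennreal (L powr p) * (ennreal (\<omega> x) * indicator ?B x) \<partial>lebesgue)"
    using bound
  proof (intro nn_integral_mono_AE, eventually_elim)
    fix x assume x: "x \<in> ?B \<longrightarrow> \<bar>f x - avg ?B f\<bar> \<le> L"
    show "ennreal (\<bar>f x - avg ?B f\<bar> powr p * \<omega> x) * indicator ?B x \<le>
        ennreal (L powr p) * (ennreal (\<omega> x) * indicator ?B x)"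
      using x p L pos[of x]
      by (auto simp: indicator_def ennreal_mult[symmetric] intro!: ennreal_leI mult_right_mono powr_mono2)
  qed
  also have "\<dots> = ennreal (L powr p) * w"
    unfolding w_def wmeasure_def by (intro nn_integral_cmult) measurable
  finally have "(\<integral>\<^sup>+x\<in>?B. ennreal (\<bar>f x - avg ?B f\<bar> powr p * \<omega> x) \<partial>lebesgue) / w \<le>
      ennreal (L powr p) * w / w"
    by (rule divide_right_mono_ennreal)
  also have "\<dots> \<le> ennreal (L powr p)"
    using wmeasure_ball_finite[OF \<omega>, of x\<^sub>0 r] 
    by (cases "w = 0") (auto simp: w_def[symmetric] mult_divide_eq_ennreal)
  finally have "epow ((\<integral>\<^sup>+x\<in>?B. ennreal (\<bar>f x - avg ?B f\<bar> powr p * \<omega> x) \<partial>lebesgue) / w) (1 / p)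
      \<le> epow (ennreal (L powr p)) (1 / p)"
    using p by (intro epow_mono) auto
  also have "\<dots> = ennreal L"
    using p L by (simp add: epow_ennreal powr_powr)
  finally have "weighted_osc p \<beta> \<omega> f ?B \<le> ennreal (1 / measure lebesgue ?B powr (\<beta> / DIM('a))) * ennreal L"
    unfolding weighted_osc_def w_def by (intro mult_left_mono) auto
  then show ?thesis
    using L by (simp add: ennreal_mult[symmetric])
qed

section \<open>Averages and the weight condition\<close>

text \<open>A function dominates its essential infimum almost everywhere: it dominates every
  smaller constant almost everywhere, and countably many of these approach the essential infimum.\<close>
lemma AE_Liminf_le:
  fixes g :: "'a \<Rightarrow> ennreal"
  shows "AE x in M. Liminf (ae_filter M) g \<le> g x"
proof (cases "Liminf (ae_filter M) g = 0")
  case False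
  define l where "l = Liminf (ae_filter M) g"
  have "0 < l" using False by (simp add: l_def zero_less_iff_neq_zero)
  then obtain u :: "nat \<Rightarrow> ennreal" where u: "\<And>n. u n < l" "u \<longlonglongrightarrow> l"
    using approx_from_below_dense_linorder[of 0 l] by auto
  have "AE x in M. u n < g x" for n
    using u(1)[of n] unfolding l_def by (rule less_LiminfD)
  then have "AE x in M. \<forall>n. u n < g x"
    by (simp add: AE_all_countable)
  then show ?thesis
    unfolding l_def[symmetric]
  proof eventually_elim
    case (elim x)
    then show ?case
      using u(2) by (intro LIMSEQ_le_const2) (auto intro: less_imp_le)
  qed
qed simp

lemma Ap_char_ball_le:
  fixes \<rho> :: "'a::euclidean_space \<Rightarrow> real"
  assumes "0 < r"
  shows "p = 1 \<Longrightarrow> ennreal ((1 + r / \<rho> x) powr (- \<theta>)) * (eavg (ball x r) (\<lambda>x. ennreal (\<omega> x)) *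
        inverse (Liminf (ae_filter (lebesgue_on (ball x r))) (\<lambda>x. ennreal (\<omega> x)))) \<le> Ap_char \<rho> \<theta> p \<omega>"
    and "p \<noteq> 1 \<Longrightarrow> ennreal ((1 + r / \<rho> x) powr (- \<theta>)) *
        (epow (eavg (ball x r) (\<lambda>x. ennreal (\<omega> x))) (1 / p) *
        epow (eavg (ball x r) (\<lambda>x. inverse (ennreal (\<omega> x powr (conj_exp p / p))))) (1 / conj_exp p))
        \<le> Ap_char \<rho> \<theta> p \<omega>"
  using assms unfolding Ap_char_def by (auto intro!: SUP_upper2[where i="(x, r)"])

lemma emeasure_ball_pos_finite:
  fixes x :: "'a::euclidean_space"
  assumes "0 < r"
  shows "emeasure lebesgue (ball x r) = ennreal (measure lebesgue (ball x r))"
    and "0 < measure lebesgue (ball x r)"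
proof -
  have "ball x r \<in> lmeasurable" by (rule lmeasurable_ball)
  then show "emeasure lebesgue (ball x r) = ennreal (measure lebesgue (ball x r))"
    by (rule emeasure_eq_measure2)
  show "0 < measure lebesgue (ball x r)" using assms by (simp add: content_ball_pos)
qed

text \<open>Since \<open>0 \<cdot> \<infinity> = 0\<close>, a ball on which \<open>\<omega>\<close> vanishes identically puts no constraint on the
  characteristic. On a ball with \<open>\<omega>(B) > 0\<close>, however, the first factor is positive, so the second
  one is finite, which excludes zeros of \<open>\<omega>\<close> on a set of positive measure.\<close>
lemma Ap_class_pos_on_ball:
  fixes \<omega> :: "'a::euclidean_space \<Rightarrow> real"
  assumes Ap: "Ap_char \<rho> \<theta> p \<omega> < \<infinity>" and \<omega>: "weight \<omega>" and \<rho>: "0 < \<rho> x" and r: "0 < r"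
    and pos: "0 < wmeasure \<omega> (ball x r)" and p: "1 \<le> p"
  shows "AE y in lebesgue. y \<in> ball x r \<longrightarrow> 0 < \<omega> y"
proof -
  let ?B = "ball x r"
  have [measurable]: "\<omega> \<in> borel_measurable lebesgue" by (rule weight_measurable[OF \<omega>])
  have B[measurable]: "?B \<in> sets lebesgue" by auto
  have nonneg: "0 \<le> \<omega> y" for y using \<omega> by (simp add: weight_def)
  note m = emeasure_ball_pos_finite[OF r, of x]
  define e where "e = eavg ?B (\<lambda>x. ennreal (\<omega> x))"
  have e: "e \<noteq> 0"
    using pos m by (auto simp: e_def eavg_def wmeasure_def ennreal_divide_eq_0_iff)
  have k: "ennreal ((1 + r / \<rho> x) powr (- \<theta>)) \<noteq> 0"
    using r \<rho> by (simp add: add_pos_pos less_imp_neq[symmetric])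
  show ?thesis
  proof (cases "p = 1")
    case True
    define l where "l = Liminf (ae_filter (lebesgue_on ?B)) (\<lambda>x. ennreal (\<omega> x))"
    have "l \<noteq> 0"
    proof
      assume "l = 0"
      then have "ennreal ((1 + r / \<rho> x) powr (- \<theta>)) * (e * inverse l) = \<infinity>"
        using e k by (simp add: ennreal_mult_top)
      then show False
        using Ap_char_ball_le(1)[OF r True, of \<rho> x \<theta> \<omega>] Ap by (simp add: e_def l_def)
    qed
    have "AE y in lebesgue_on ?B. l \<le> ennreal (\<omega> y)"
      unfolding l_def by (rule AE_Liminf_le)
    then have "AE y in lebesgue_on ?B. 0 < \<omega> y"
    proof eventually_elim
      case (elim y)
      then show ?case using \<open>l \<noteq> 0\<close> nonneg[of y] by (cases "\<omega> y = 0") auto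
    qed
    then show ?thesis
      by (simp add: AE_restrict_space_iff)
  next
    case False
    define q where "q = conj_exp p"
    have "epow e (1 / p) \<noteq> 0"
      using e p by (cases e) (auto simp: epow_def)
    define D where "D = (\<integral>\<^sup>+y\<in>?B. inverse (ennreal (\<omega> y powr (q / p))) \<partial>lebesgue)"
    have "D \<noteq> \<infinity>"
    proof
      assume "D = \<infinity>"
      then have "eavg ?B (\<lambda>x. inverse (ennreal (\<omega> x powr (q / p)))) = \<infinity>"
        using m by (simp add: eavg_def D_def ennreal_top_divide)
      then have "ennreal ((1 + r / \<rho> x) powr (- \<theta>)) *
          (epow e (1 / p) * epow (eavg ?B (\<lambda>x. inverse (ennreal (\<omega> x powr (q / p))))) (1 / q)) = \<infinity>"
        using \<open>epow e (1 / p) \<noteq> 0\<close> k by (simp add: epow_def[of top] ennreal_mult_top)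
      then show False
        using Ap_char_ball_le(2)[OF r False, of \<rho> x \<theta> \<omega>] Ap by (simp add: e_def q_def)
    qed
    then have "AE y in lebesgue. inverse (ennreal (\<omega> y powr (q / p))) * indicator ?B y \<noteq> \<infinity>"
      unfolding D_def by (intro nn_integral_PInf_AE) auto
    then show ?thesis
    proof eventually_elim
      case (elim y)
      then show ?case using nonneg[of y] by (cases "\<omega> y = 0") auto
    qed
  qed
qed

text \<open>As \<open>\<omega>\<close> is not almost everywhere \<open>0\<close>, all sufficiently large balls around the origin have
  positive weight, and these cover the space.\<close>
lemma Ap_class_pos:
  fixes \<omega> :: "'a::euclidean_space \<Rightarrow> real"
  assumes \<omega>: "\<omega> \<in> Ap_class \<rho> \<theta> p" and \<rho>: "\<And>x. 0 < \<rho> x" and p: "1 \<le> p"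
  shows "AE x in lebesgue. 0 < \<omega> x"
proof -
  have wt: "weight \<omega>" and Ap: "Ap_char \<rho> \<theta> p \<omega> < \<infinity>" using \<omega> by (auto simp: Ap_class_def)
  have [measurable]: "\<omega> \<in> borel_measurable lebesgue" by (rule weight_measurable[OF wt])
  have nonneg: "0 \<le> \<omega> y" for y using wt by (simp add: weight_def)
  have in_ball: "\<exists>N. \<forall>n\<ge>N. x \<in> ball 0 (real (Suc n))" for x :: 'a
  proof -
    obtain N where "norm x \<le> real N" using real_arch_simple by blast
    then show ?thesis by (intro exI[of _ N]) auto
  qed
  have meas: "(\<lambda>x. ennreal (\<omega> x) * indicator (ball 0 R) x) \<in> borel_measurable lebesgue" for R
  proof -
    have [measurable]: "ball (0 :: 'a) R \<in> sets lebesgue" by auto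
    show ?thesis by measurable
  qed
  obtain n\<^sub>0 where n0: "0 < wmeasure \<omega> (ball 0 (real (Suc n\<^sub>0)))"
  proof (rule ccontr)
    assume "\<not> thesis"
    then have "wmeasure \<omega> (ball 0 (real (Suc n))) = 0" for n
      using that by (auto simp: zero_less_iff_neq_zero)
    then have "AE x in lebesgue. ennreal (\<omega> x) * indicator (ball 0 (real (Suc n))) x = 0" for n
      unfolding wmeasure_def by (rule nn_integral_0_iff_AE[OF meas, THEN iffD1])
    then have "AE x in lebesgue. \<forall>n. ennreal (\<omega> x) * indicator (ball 0 (real (Suc n))) x = 0"
      unfolding AE_all_countable by blast
    then have "AE x in lebesgue. \<omega> x = 0"
    proof eventually_elim
      case (elim x)
      obtain N where "x \<in> ball 0 (real (Suc N))" using in_ball by blast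
      then show ?case using elim[rule_format, of N] nonneg[of x] by auto
    qed
    then show False using wt by (simp add: weight_def)
  qed
  have "AE x in lebesgue. x \<in> ball 0 (real (Suc (n\<^sub>0 + n))) \<longrightarrow> 0 < \<omega> x" for n
  proof (rule Ap_class_pos_on_ball[OF Ap wt \<rho> _ _ p])
    have "wmeasure \<omega> (ball 0 (real (Suc n\<^sub>0))) \<le> wmeasure \<omega> (ball 0 (real (Suc (n\<^sub>0 + n))))"
      unfolding wmeasure_def by (intro nn_integral_mono) (auto simp: indicator_def)
    with n0 show "0 < wmeasure \<omega> (ball 0 (real (Suc (n\<^sub>0 + n))))" by (rule less_le_trans)
  qed simp
  then have "AE x in lebesgue. \<forall>n. x \<in> ball 0 (real (Suc (n\<^sub>0 + n))) \<longrightarrow> 0 < \<omega> x"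
    unfolding AE_all_countable by blast
  then show ?thesis
  proof eventually_elim
    case (elim x)
    obtain N where "\<forall>n\<ge>N. x \<in> ball 0 (real (Suc n))" using in_ball by blast
    then have "x \<in> ball 0 (real (Suc (n\<^sub>0 + N)))" using le_add2 by blast
    then show ?case using elim by blast
  qed
qed

text \<open>Young's inequality for \<open>g w\<^bsup>1/p\<^esup> / a\<^bsup>1/p\<^esup>\<close> and \<open>w\<^bsup>-1/p\<^esup> / b\<^bsup>1/q\<^esup>\<close>. When \<open>a\<close> and \<open>b\<close> bound the
  integrals of \<open>g\<^bsup>p\<^esup> w\<close> and \<open>w\<^bsup>-q/p\<^esup>\<close>, the right-hand side integrates to at most
  \<open>a\<^bsup>1/p\<^esup> b\<^bsup>1/q\<^esup> (1/p + 1/q)\<close>.\<close>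
lemma weighted_Young:
  fixes g w a b p q :: real
  assumes "0 \<le> g" "0 < w" "0 < a" "0 < b" and pq: "1 < p" "1 < q" "1 / p + 1 / q = 1"
  shows "g \<le> a powr (1 / p) * b powr (1 / q) / (a * p) * (g powr p * w) +
    a powr (1 / p) * b powr (1 / q) / (b * q) * inverse (w powr (q / p))"
proof -
  define c where "c = a powr (1 / p) * b powr (1 / q)"
  define G where "G = g * w powr (1 / p) / a powr (1 / p)"
  define W where "W = inverse (w powr (1 / p)) / b powr (1 / q)"
  have c: "0 < c" using assms by (simp add: c_def)
  have "0 \<le> G" "0 \<le> W" using assms by (auto simp: G_def W_def)
  then have "G * W \<le> G powr p / p + W powr q / q"
    using pq by (intro Youngs_inequality) auto
  moreover have "G * W = g / c"
    using assms by (simp add: G_def W_def c_def field_simps)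
  moreover have "G powr p = g powr p * w / a"
    using assms by (simp add: G_def powr_mult powr_divide powr_powr)
  moreover have "W powr q = inverse (w powr (q / p)) / b"
    using assms by (simp add: W_def powr_mult powr_divide powr_powr inverse_powr)
  ultimately have "g / c \<le> g powr p * w / a / p + inverse (w powr (q / p)) / b / q"
    by simp
  then have "c * (g / c) \<le> c * (g powr p * w / a / p + inverse (w powr (q / p)) / b / q)"
    using c by (intro mult_left_mono) auto
  then show ?thesis
    using c unfolding c_def[symmetric] by (simp add: distrib_left field_simps)
qed

text \<open>Hoelder's inequality for \<open>g w\<^bsup>1/p\<^esup>\<close> and \<open>w\<^bsup>-1/p\<^esup>\<close>. Positive upper bounds \<open>a\<close>, \<open>b\<close> stand in for
  the integrals, so that the normalisation never divides by \<open>0\<close>.\<close>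
lemma weighted_Holder:
  fixes g w :: "'a \<Rightarrow> real"
  assumes [measurable]: "g \<in> borel_measurable M" "w \<in> borel_measurable M" "B \<in> sets M"
    and g: "\<And>x. 0 \<le> g x" and w: "AE x in M. x \<in> B \<longrightarrow> 0 < w x"
    and pq: "1 < p" "1 < q" "1 / p + 1 / q = 1" and ab: "0 < a" "0 < b"
    and A: "(\<integral>\<^sup>+x\<in>B. ennreal (g x powr p * w x) \<partial>M) \<le> ennreal a"
    and D: "(\<integral>\<^sup>+x\<in>B. inverse (ennreal (w x powr (q / p))) \<partial>M) \<le> ennreal b"
  shows "(\<integral>\<^sup>+x\<in>B. ennreal (g x) \<partial>M) \<le> ennreal (a powr (1 / p) * b powr (1 / q))"
proof -
  define c where "c = a powr (1 / p) * b powr (1 / q)"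
  have c: "0 < c" using ab by (simp add: c_def)
  have linear_comb: "ennreal (s * X + t * Y) = ennreal s * ennreal X + ennreal t * ennreal Y"
    if "0 \<le> s" "0 \<le> X" "0 \<le> t" "0 \<le> Y" for s t X Y :: real
    using that by (simp add: ennreal_plus ennreal_mult)
  have "(\<integral>\<^sup>+x\<in>B. ennreal (g x) \<partial>M) \<le>
    (\<integral>\<^sup>+x. ennreal (c / (a * p)) * (ennreal (g x powr p * w x) * indicator B x) +
      ennreal (c / (b * q)) * (inverse (ennreal (w x powr (q / p))) * indicator B x) \<partial>M)"
    using w
  proof (intro nn_integral_mono_AE, eventually_elim)
    case (elim x)
    show ?case
    proof (cases "x \<in> B")
      case True
      with elim have wx: "0 < w x" by simp
      have "ennreal (g x) \<le> ennreal (c / (a * p) * (g x powr p * w x) + c / (b * q) * inverse (w x powr (q / p)))"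
        using weighted_Young[OF g[of x] wx ab pq] unfolding c_def by (rule ennreal_leI)
      also have "\<dots> = ennreal (c / (a * p)) * ennreal (g x powr p * w x) +
          ennreal (c / (b * q)) * inverse (ennreal (w x powr (q / p)))"
        using wx c ab pq by (subst linear_comb) (auto simp: inverse_ennreal)
      finally show ?thesis using True by simp
    qed simp
  qed
  also have "\<dots> = ennreal (c / (a * p)) * (\<integral>\<^sup>+x\<in>B. ennreal (g x powr p * w x) \<partial>M) +
      ennreal (c / (b * q)) * (\<integral>\<^sup>+x\<in>B. inverse (ennreal (w x powr (q / p))) \<partial>M)"
    by (simp add: nn_integral_add nn_integral_cmult)
  also have "\<dots> \<le> ennreal (c / (a * p)) * ennreal a + ennreal (c / (b * q)) * ennreal b"
    using A D by (intro add_mono mult_left_mono) auto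
  also have "\<dots> = ennreal (c / (a * p) * a + c / (b * q) * b)"
    using c ab pq by (subst linear_comb) auto
  also have "c / (a * p) * a + c / (b * q) * b = c * (1 / p + 1 / q)"
    using ab by (simp add: distrib_left)
  finally show ?thesis using pq by (simp add: c_def)
qed

text \<open>The condition \<open>A\<^sub>p\<close> in the form in which it is used: plain averages are controlled by weighted
  \<open>p\<close>-means. For \<open>p > 1\<close> this is Hoelder's inequality; for \<open>p = 1\<close> the weight is bounded below by
  its essential infimum.\<close>
lemma Ap_average_le:
  fixes g \<omega> :: "'a::euclidean_space \<Rightarrow> real"
  assumes \<omega>: "\<omega> \<in> Ap_class \<rho> \<theta> p" and \<rho>: "\<And>x. 0 < \<rho> x" and p: "1 \<le> p" and r: "0 < r" and L: "0 < L"
    and [measurable]: "g \<in> borel_measurable lebesgue" and g: "\<And>x. 0 \<le> g x"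
    and mean: "epow ((\<integral>\<^sup>+x\<in>ball x\<^sub>0 r. ennreal (g x powr p * \<omega> x) \<partial>lebesgue) / wmeasure \<omega> (ball x\<^sub>0 r)) (1 / p)
      \<le> ennreal L"
  shows "(\<integral>\<^sup>+x\<in>ball x\<^sub>0 r. ennreal (g x) \<partial>lebesgue) \<le>
    ennreal (L * measure lebesgue (ball x\<^sub>0 r) * (1 + r / \<rho> x\<^sub>0) powr \<theta>) * Ap_char \<rho> \<theta> p \<omega>"
proof -
  let ?B = "ball x\<^sub>0 r"
  have wt: "weight \<omega>" and Ap: "Ap_char \<rho> \<theta> p \<omega> < \<infinity>" using \<omega> by (auto simp: Ap_class_def)
  have [measurable]: "\<omega> \<in> borel_measurable lebesgue" by (rule weight_measurable[OF wt])
  have B[measurable]: "?B \<in> sets lebesgue" by auto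
  have pos: "AE x in lebesgue. 0 < \<omega> x" using Ap_class_pos[OF \<omega> \<rho> p] .
  define m where "m = measure lebesgue ?B"
  have m: "0 < m" "emeasure lebesgue ?B = ennreal m"
    using emeasure_ball_pos_finite[OF r, of x\<^sub>0] by (auto simp: m_def)
  define k where "k = (1 + r / \<rho> x\<^sub>0) powr \<theta>"
  have k: "0 < k" using r \<rho>[of x\<^sub>0] by (simp add: k_def add_pos_pos less_imp_neq[symmetric])
  have k': "(1 + r / \<rho> x\<^sub>0) powr (- \<theta>) = 1 / k" by (simp add: k_def powr_minus field_simps)
  have null_B: False if "AE x in lebesgue. x \<notin> ?B"
  proof -
    have "?B \<in> null_sets lebesgue" using that by (subst AE_iff_null_sets[OF B]) 
    then show False using m by auto
  qed
  have int_pos: "0 < (\<integral>\<^sup>+x\<in>?B. h x \<partial>lebesgue)" if "AE x in lebesgue. 0 < h x" "h \<in> borel_measurable lebesgue"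
    for h :: "'a \<Rightarrow> ennreal"
  proof -
    note that(2)[measurable]
    have "(\<integral>\<^sup>+x\<in>?B. h x \<partial>lebesgue) \<noteq> 0"
    proof
      assume "(\<integral>\<^sup>+x\<in>?B. h x \<partial>lebesgue) = 0"
      then have "AE x in lebesgue. h x * indicator ?B x = 0"
        by (subst (asm) nn_integral_0_iff_AE) auto
      with that(1) have "AE x in lebesgue. x \<notin> ?B"
        by eventually_elim (auto simp: indicator_def split: if_splits)
      then show False by (rule null_B)
    qed
    then show ?thesis by (simp add: zero_less_iff_neq_zero)
  qed
  obtain w where w: "wmeasure \<omega> ?B = ennreal w" "0 < w"
  proof -
    have "0 < wmeasure \<omega> ?B"
      unfolding wmeasure_def using pos by (intro int_pos) auto
    with wmeasure_ball_finite[OF wt, of x\<^sub>0 r] show thesis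
      using that by (cases "wmeasure \<omega> ?B") auto
  qed
  define Ar where "Ar = enn2real (Ap_char \<rho> \<theta> p \<omega>)"
  have Ar: "Ap_char \<rho> \<theta> p \<omega> = ennreal Ar" "0 \<le> Ar" using Ap by (auto simp: Ar_def)
  define A where "A = (\<integral>\<^sup>+x\<in>?B. ennreal (g x powr p * \<omega> x) \<partial>lebesgue)"
  have A: "A \<le> ennreal (L powr p * w)"
  proof -
    obtain a where a: "A / ennreal w = ennreal a" "0 \<le> a"
      using mean by (cases "A / ennreal w") (auto simp: epow_def A_def w top_unique)
    have "a powr (1 / p) \<le> L"
      using mean a L by (simp add: A_def[symmetric] w epow_ennreal)
    then have "(a powr (1 / p)) powr p \<le> L powr p"
      using p by (intro powr_mono2) auto
    then have "a \<le> L powr p" using p a by (simp add: powr_powr)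
    moreover have "A = ennreal (a * w)"
    proof -
      have "A = A / ennreal w * ennreal w"
        using w by (simp add: ennreal_divide_times ennreal_divide_self)
      then show ?thesis using a w by (simp add: ennreal_mult)
    qed
    ultimately show ?thesis using w by (simp add: ennreal_leI mult_right_mono)
  qed
  have eavg_\<omega>: "eavg ?B (\<lambda>x. ennreal (\<omega> x)) = ennreal (w / m)"
    using w m by (simp add: eavg_def wmeasure_def[symmetric] divide_ennreal)
  show ?thesis
  proof (cases "p = 1")
    case True
    define l where "l = Liminf (ae_filter (lebesgue_on ?B)) (\<lambda>x. ennreal (\<omega> x))"
    have le: "AE x in lebesgue. x \<in> ?B \<longrightarrow> l \<le> ennreal (\<omega> x)"
      using AE_Liminf_le[of "lebesgue_on ?B" "\<lambda>x. ennreal (\<omega> x)"]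
      by (simp add: AE_restrict_space_iff l_def)
    have char: "ennreal (1 / k) * (ennreal (w / m) * inverse l) \<le> ennreal Ar"
      using Ap_char_ball_le(1)[OF r True, of \<rho> x\<^sub>0 \<theta> \<omega>] Ar
      unfolding l_def[symmetric] eavg_\<omega> k' by simp
    have "l \<noteq> 0"
      using char k w m by (auto simp: ennreal_mult_top top_unique)
    moreover have "l \<noteq> \<infinity>"
    proof
      assume "l = \<infinity>"
      with le have "AE x in lebesgue. x \<notin> ?B" by (auto simp: top_unique)
      then show False by (rule null_B)
    qed
    ultimately obtain l' where l': "l = ennreal l'" "0 < l'"
      by (cases l) auto
    have "ennreal (w / (m * k * l')) \<le> ennreal Ar"
    proof -
      have "ennreal (1 / k) * (ennreal (w / m) * inverse l) = ennreal (1 / k * (w / m * inverse l'))"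
        using l' k w m by (simp add: inverse_ennreal ennreal_mult[symmetric] mult_ac)
      also have "1 / k * (w / m * inverse l') = w / (m * k * l')"
        by (simp add: field_simps)
      finally show ?thesis using char by simp
    qed
    then have char': "w \<le> Ar * (m * k * l')"
      using Ar k m l' by (simp add: ennreal_le_iff pos_divide_le_eq)
    have "l * (\<integral>\<^sup>+x\<in>?B. ennreal (g x) \<partial>lebesgue) = (\<integral>\<^sup>+x. l * (ennreal (g x) * indicator ?B x) \<partial>lebesgue)"
      by (simp add: nn_integral_cmult)
    also have "\<dots> \<le> A"
      unfolding A_def using le
    proof (intro nn_integral_mono_AE, eventually_elim)
      case (elim x)
      moreover have "0 \<le> \<omega> x" using wt by (simp add: weight_def)
      ultimately show ?case
        using g[of x] mult_right_mono[of l "ennreal (\<omega> x)" "ennreal (g x)"] True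
        by (auto simp: indicator_def ennreal_mult mult.commute)
    qed
    also note A
    also have "ennreal (L powr p * w) \<le> ennreal (L * (Ar * (m * k * l')))"
      using True L char' by (intro ennreal_leI) simp
    also have "\<dots> = l * ennreal (L * m * k * Ar)"
      using l' L m k Ar by (simp add: ennreal_mult[symmetric] mult_ac)
    finally have "(\<integral>\<^sup>+x\<in>?B. ennreal (g x) \<partial>lebesgue) \<le> ennreal (L * m * k * Ar)"
      using l' by (simp add: ennreal_mult_le_mult_iff)
    then show ?thesis
      using L m k Ar by (simp add: ennreal_mult m_def k_def)
  next
    case False
    then have p1: "1 < p" using p by simp
    define q where "q = conj_exp p"
    have q: "1 < q" "1 / p + 1 / q = 1"
      using p1 by (auto simp: q_def conj_exp_def field_simps)
    define D where "D = (\<integral>\<^sup>+x\<in>?B. inverse (ennreal (\<omega> x powr (q / p))) \<partial>lebesgue)"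
    have char: "ennreal (1 / k) * (ennreal ((w / m) powr (1 / p)) * epow (D / ennreal m) (1 / q)) \<le> ennreal Ar"
      using Ap_char_ball_le(2)[OF r False, of \<rho> x\<^sub>0 \<theta> \<omega>] Ar w m
      unfolding eavg_\<omega> k' q_def[symmetric] by (simp add: eavg_def D_def epow_ennreal)
    have "D \<noteq> \<infinity>"
    proof
      assume "D = \<infinity>"
      then have "epow (D / ennreal m) (1 / q) = \<infinity>"
        by (simp add: ennreal_top_divide epow_def)
      then show False
        using char k w m by (auto simp: ennreal_mult_top top_unique)
    qed
    moreover have "0 < D"
      unfolding D_def by (intro int_pos) (auto simp: ennreal_inverse_positive)
    ultimately obtain b where b: "D = ennreal b" "0 < b"
      by (cases D) auto
    have "ennreal (1 / k * ((w / m) powr (1 / p) * (b / m) powr (1 / q))) \<le> ennreal Ar"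
      using char b m k by (simp add: divide_ennreal epow_ennreal ennreal_mult[symmetric])
    then have char': "(w / m) powr (1 / p) * (b / m) powr (1 / q) \<le> Ar * k"
      using Ar k by (simp add: ennreal_le_iff pos_divide_le_eq)
    have "(\<integral>\<^sup>+x\<in>?B. ennreal (g x) \<partial>lebesgue) \<le>
        ennreal ((L powr p * w) powr (1 / p) * b powr (1 / q))"
    proof (rule weighted_Holder[OF _ _ B g _ p1 q, where w = \<omega>])
      show "AE x in lebesgue. x \<in> ?B \<longrightarrow> 0 < \<omega> x" using pos by auto
      show "(\<integral>\<^sup>+x\<in>?B. ennreal (g x powr p * \<omega> x) \<partial>lebesgue) \<le> ennreal (L powr p * w)"
        using A by (simp add: A_def)
      show "(\<integral>\<^sup>+x\<in>?B. inverse (ennreal (\<omega> x powr (q / p))) \<partial>lebesgue) \<le> ennreal b"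
        using b by (simp add: D_def)
    qed (use L w b in auto)
    also have "(L powr p * w) powr (1 / p) * b powr (1 / q) = L * m * ((w / m) powr (1 / p) * (b / m) powr (1 / q))"
    proof -
      have "m powr (1 / p) * m powr (1 / q) = m"
        using m q by (simp flip: powr_add)
      then show ?thesis
        using L w b m p1 by (simp add: powr_mult powr_divide powr_powr field_simps)
    qed
    also have "ennreal \<dots> \<le> ennreal (L * m * (Ar * k))"
      using char' L m by (intro ennreal_leI mult_left_mono) auto
    also have "\<dots> = ennreal (L * m * k) * ennreal Ar"
      using L m k Ar by (simp add: ennreal_mult[symmetric] mult_ac)
    finally show ?thesis using Ar by (simp add: m_def k_def)
  qed
qed

section \<open>The two inequalities\<close>
lemma weighted_osc_le_Lip_norm:
  fixes \<omega> :: "'a::euclidean_space \<Rightarrow> real"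
  assumes shen: "shen_constants \<rho> C\<^sub>0 N\<^sub>0" and \<omega>: "weight \<omega>" and p: "0 < p" and \<beta>: "0 < \<beta>" and \<theta>: "0 \<le> \<theta>"
  shows "\<exists>C>0. \<forall>f \<in> Lip_space \<rho> \<theta> \<beta>. \<forall>x\<^sub>0. \<forall>r>0.
    weighted_osc p \<beta> \<omega> f (ball x\<^sub>0 r) \<le>
      ennreal (C * (1 + r / \<rho> x\<^sub>0) powr ((N\<^sub>0 + 1) * \<theta>)) * Lip_norm \<rho> \<theta> \<beta> f"
proof -
  define C where "C = (campanato_const DIM('a) \<beta> + 2 ^ DIM('a)) * 2 powr \<beta> * (2 * C\<^sub>0) powr \<theta>"
  have "1 \<le> C\<^sub>0" using shen by (simp add: shen_constants_def)
  then have C: "0 < C"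
    using campanato_const_nonneg[OF \<beta>, of "DIM('a)"] by (simp add: C_def add_nonneg_pos)
  have "weighted_osc p \<beta> \<omega> f (ball x\<^sub>0 r) \<le>
      ennreal (C * (1 + r / \<rho> x\<^sub>0) powr ((N\<^sub>0 + 1) * \<theta>)) * Lip_norm \<rho> \<theta> \<beta> f"
    if f: "f \<in> Lip_space \<rho> \<theta> \<beta>" and r: "0 < r" for f x\<^sub>0 r
  proof -
    define M where "M = enn2real (Lip_norm \<rho> \<theta> \<beta> f)"
    have M: "Lip_norm \<rho> \<theta> \<beta> f = ennreal M" "0 \<le> M"
      using f by (auto simp: M_def Lip_space_def)
    define a where "a = measure lebesgue (ball x\<^sub>0 r) powr (\<beta> / DIM('a))"
    have a: "0 < a" using emeasure_ball_pos_finite(2)[OF r, of x\<^sub>0] by (simp add: a_def)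
    define L where "L = C * (1 + r / \<rho> x\<^sub>0) powr ((N\<^sub>0 + 1) * \<theta>) * M"
    have L: "0 \<le> L" using C M by (simp add: L_def)
    have "AE x in lebesgue. x \<in> ball x\<^sub>0 r \<longrightarrow> \<bar>f x - avg (ball x\<^sub>0 r) f\<bar> \<le> L * a"
      using Lip_space_pointwise[OF shen f r \<beta> \<theta>, of x\<^sub>0] by (simp add: L_def C_def M_def a_def)
    then have "weighted_osc p \<beta> \<omega> f (ball x\<^sub>0 r) \<le> ennreal (L * a / a)"
      unfolding a_def using L by (intro weighted_mean_le[OF \<omega> p]) auto
    then show ?thesis
      using a C M by (simp add: L_def ennreal_mult)
  qed
  then show ?thesis using C by blast
qed

lemma Lip_norm_le_Ap_char:
  fixes f :: "'a::euclidean_space \<Rightarrow> real"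
  assumes \<rho>: "\<And>x. 0 < \<rho> x" and \<omega>: "\<omega> \<in> Ap_class \<rho> \<theta>\<^sub>2 p" and p: "1 \<le> p" and C: "0 < C"
    and f: "locally_integrable f"
    and osc: "\<And>x\<^sub>0 r. 0 < r \<Longrightarrow> weighted_osc p \<beta> \<omega> f (ball x\<^sub>0 r) \<le>
      ennreal (C * (1 + r / \<rho> x\<^sub>0) powr (\<theta>\<^sub>1 - \<theta>\<^sub>2))"
  shows "Lip_norm \<rho> \<theta>\<^sub>1 \<beta> f \<le> ennreal C * Ap_char \<rho> \<theta>\<^sub>2 p \<omega>"
  unfolding Lip_norm_def
proof (rule SUP_least, clarsimp)
  fix x\<^sub>0 :: 'a and r :: real assume r: "0 < r"
  let ?B = "ball x\<^sub>0 r"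
  define m where "m = measure lebesgue ?B"
  have m: "0 < m" using emeasure_ball_pos_finite(2)[OF r, of x\<^sub>0] by (simp add: m_def)
  define u where "u = 1 + r / \<rho> x\<^sub>0"
  have u: "0 < u" using r \<rho>[of x\<^sub>0] by (simp add: u_def add_pos_pos)
  define a where "a = m powr (\<beta> / DIM('a))"
  have a: "0 < a" using m by (simp add: a_def)
  define L where "L = C * u powr (\<theta>\<^sub>1 - \<theta>\<^sub>2) * a"
  have L: "0 < L" using C u a by (simp add: L_def)
  define E where "E = epow ((\<integral>\<^sup>+x\<in>?B. ennreal (\<bar>f x - avg ?B f\<bar> powr p * \<omega> x) \<partial>lebesgue) / wmeasure \<omega> ?B) (1 / p)"
  have "ennreal (1 / a) * E \<le> ennreal (C * u powr (\<theta>\<^sub>1 - \<theta>\<^sub>2))"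
    using osc[OF r, of x\<^sub>0] by (simp add: weighted_osc_def E_def a_def m_def u_def)
  then have "ennreal a * (ennreal (1 / a) * E) \<le> ennreal a * ennreal (C * u powr (\<theta>\<^sub>1 - \<theta>\<^sub>2))"
    by (rule mult_left_mono) simp
  moreover have "ennreal a * (ennreal (1 / a) * E) = E"
    using a by (simp add: mult.assoc[symmetric] ennreal_mult[symmetric])
  moreover have "ennreal a * ennreal (C * u powr (\<theta>\<^sub>1 - \<theta>\<^sub>2)) = ennreal L"
    using a C by (simp add: L_def ennreal_mult[symmetric] mult_ac)
  ultimately have "E \<le> ennreal L" by simp
  then have "(\<integral>\<^sup>+x\<in>?B. ennreal \<bar>f x - avg ?B f\<bar> \<partial>lebesgue) \<le>
      ennreal (L * m * u powr \<theta>\<^sub>2) * Ap_char \<rho> \<theta>\<^sub>2 p \<omega>"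
    unfolding m_def u_def E_def using locally_integrable_measurable[OF f]
    by (intro Ap_average_le[OF \<omega> \<rho> p r L]) auto
  then have "ennreal (u powr - \<theta>\<^sub>1 * (1 / m powr (1 + \<beta> / DIM('a)))) *
      (\<integral>\<^sup>+x\<in>?B. ennreal \<bar>f x - avg ?B f\<bar> \<partial>lebesgue) \<le>
      ennreal (u powr - \<theta>\<^sub>1 * (1 / m powr (1 + \<beta> / DIM('a)))) *
      (ennreal (L * m * u powr \<theta>\<^sub>2) * Ap_char \<rho> \<theta>\<^sub>2 p \<omega>)"
    by (rule mult_left_mono) simp
  also have "\<dots> = ennreal (u powr - \<theta>\<^sub>1 * (1 / m powr (1 + \<beta> / DIM('a))) * (L * m * u powr \<theta>\<^sub>2)) *
      Ap_char \<rho> \<theta>\<^sub>2 p \<omega>"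
    using L m by (simp add: mult.assoc[symmetric] ennreal_mult[symmetric])
  also have "u powr - \<theta>\<^sub>1 * (1 / m powr (1 + \<beta> / DIM('a))) * (L * m * u powr \<theta>\<^sub>2) = C"
  proof -
    have "u powr - \<theta>\<^sub>1 * u powr (\<theta>\<^sub>1 - \<theta>\<^sub>2) * u powr \<theta>\<^sub>2 = 1"
      using u by (simp flip: powr_add)
    moreover have "m powr (1 + \<beta> / DIM('a)) = m * a"
      using m by (simp add: powr_add a_def)
    ultimately show ?thesis
      using m a by (simp add: L_def mult_ac)
  qed
  finally show "ennreal ((1 + r / \<rho> x\<^sub>0) powr - \<theta>\<^sub>1 / measure lborel ?B powr (1 + \<beta> / DIM('a))) *
      (\<integral>\<^sup>+x\<in>?B. ennreal \<bar>f x - avg ?B f\<bar> \<partial>lebesgue) \<le> ennreal C * Ap_char \<rho> \<theta>\<^sub>2 p \<omega>"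
    by (simp add: u_def m_def)
qed

theorem theorem3p4:
  fixes p \<beta> \<theta>\<^sub>2 :: real
  assumes "3 \<le> CARD('n::finite)"
    and "1 \<le> p" and "0 < \<theta>\<^sub>2" and "0 < \<beta>" and "\<beta> < 1"
  shows
    "(\<forall>(V :: real ^ 'n \<Rightarrow> real) s C\<^sub>0 N\<^sub>0 \<omega> \<theta>\<^sub>1.
        admissible_potential s V \<and> shen_constants (critical_radius V) C\<^sub>0 N\<^sub>0 \<and>
        \<omega> \<in> Ap_class (critical_radius V) \<theta>\<^sub>2 p \<and> 0 < \<theta>\<^sub>1 \<longrightarrow>
        (\<exists>C>0. \<forall>f \<in> Lip_space (critical_radius V) \<theta>\<^sub>1 \<beta>. \<forall>x\<^sub>0. \<forall>r>0.
           weighted_osc p \<beta> \<omega> f (ball x\<^sub>0 r) \<le>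
           ennreal (C * (1 + r / critical_radius V x\<^sub>0) powr ((N\<^sub>0 + 1) * \<theta>\<^sub>1)) *
             Lip_norm (critical_radius V) \<theta>\<^sub>1 \<beta> f))
     \<and>
     (\<forall>C>0. \<forall>\<theta>\<^sub>1>0. \<exists>C'>0. \<forall>(V :: real ^ 'n \<Rightarrow> real) s C\<^sub>0 N\<^sub>0 \<omega> f.
        admissible_potential s V \<and> shen_constants (critical_radius V) C\<^sub>0 N\<^sub>0 \<and>
        \<omega> \<in> Ap_class (critical_radius V) \<theta>\<^sub>2 p \<and> locally_integrable f \<and>
        (\<forall>x\<^sub>0. \<forall>r>0. weighted_osc p \<beta> \<omega> f (ball x\<^sub>0 r) \<le>
           ennreal (C * (1 + r / critical_radius V x\<^sub>0) powr (\<theta>\<^sub>1 - \<theta>\<^sub>2))) \<longrightarrow>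
        f \<in> Lip_space (critical_radius V) \<theta>\<^sub>1 \<beta> \<and>
        Lip_norm (critical_radius V) \<theta>\<^sub>1 \<beta> f \<le>
          ennreal C' * Ap_char (critical_radius V) \<theta>\<^sub>2 p \<omega>)"
proof (intro conjI allI impI ballI)
  fix V :: "real ^ 'n \<Rightarrow> real" and s C\<^sub>0 N\<^sub>0 \<omega> and \<theta>\<^sub>1 :: real
  assume "admissible_potential s V \<and> shen_constants (critical_radius V) C\<^sub>0 N\<^sub>0 \<and>
    \<omega> \<in> Ap_class (critical_radius V) \<theta>\<^sub>2 p \<and> 0 < \<theta>\<^sub>1"
  then show "\<exists>C>0. \<forall>f \<in> Lip_space (critical_radius V) \<theta>\<^sub>1 \<beta>. \<forall>x\<^sub>0. \<forall>r>0.
      weighted_osc p \<beta> \<omega> f (ball x\<^sub>0 r) \<le>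
      ennreal (C * (1 + r / critical_radius V x\<^sub>0) powr ((N\<^sub>0 + 1) * \<theta>\<^sub>1)) *
        Lip_norm (critical_radius V) \<theta>\<^sub>1 \<beta> f"
    using assms by (intro weighted_osc_le_Lip_norm) (auto simp: Ap_class_def)
next
  fix C \<theta>\<^sub>1 :: real assume "0 < C" "0 < \<theta>\<^sub>1"
  show "\<exists>C'>0. \<forall>(V :: real ^ 'n \<Rightarrow> real) s C\<^sub>0 N\<^sub>0 \<omega> f.
      admissible_potential s V \<and> shen_constants (critical_radius V) C\<^sub>0 N\<^sub>0 \<and>
      \<omega> \<in> Ap_class (critical_radius V) \<theta>\<^sub>2 p \<and> locally_integrable f \<and>
      (\<forall>x\<^sub>0. \<forall>r>0. weighted_osc p \<beta> \<omega> f (ball x\<^sub>0 r) \<le>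
         ennreal (C * (1 + r / critical_radius V x\<^sub>0) powr (\<theta>\<^sub>1 - \<theta>\<^sub>2))) \<longrightarrow>
      f \<in> Lip_space (critical_radius V) \<theta>\<^sub>1 \<beta> \<and>
      Lip_norm (critical_radius V) \<theta>\<^sub>1 \<beta> f \<le> ennreal C' * Ap_char (critical_radius V) \<theta>\<^sub>2 p \<omega>"
  proof (intro exI[of _ C] conjI[OF \<open>0 < C\<close>] allI impI)
    fix V :: "real ^ 'n \<Rightarrow> real" and s C\<^sub>0 N\<^sub>0 \<omega> f
    assume hyp: "admissible_potential s V \<and> shen_constants (critical_radius V) C\<^sub>0 N\<^sub>0 \<and>
      \<omega> \<in> Ap_class (critical_radius V) \<theta>\<^sub>2 p \<and> locally_integrable f \<and>
      (\<forall>x\<^sub>0. \<forall>r>0. weighted_osc p \<beta> \<omega> f (ball x\<^sub>0 r) \<le>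
         ennreal (C * (1 + r / critical_radius V x\<^sub>0) powr (\<theta>\<^sub>1 - \<theta>\<^sub>2)))"
    then have "Lip_norm (critical_radius V) \<theta>\<^sub>1 \<beta> f \<le> ennreal C * Ap_char (critical_radius V) \<theta>\<^sub>2 p \<omega>"
      using assms(2) \<open>0 < C\<close> by (intro Lip_norm_le_Ap_char) (auto intro: shen_constants_pos)
    moreover from this have "Lip_norm (critical_radius V) \<theta>\<^sub>1 \<beta> f < \<infinity>"
      using hyp by (auto simp: Ap_class_def ennreal_mult_less_top intro: le_less_trans)
    ultimately show "f \<in> Lip_space (critical_radius V) \<theta>\<^sub>1 \<beta> \<and>
        Lip_norm (critical_radius V) \<theta>\<^sub>1 \<beta> f \<le> ennreal C * Ap_char (critical_radius V) \<theta>\<^sub>2 p \<omega>"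
      using hyp by (simp add: Lip_space_def)
  qed
qed

end
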